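(* Let $R(\lambda)\in\mathbb{F}(\lambda)^{p\times m}$ be a singular rational matrix expressed in the form $R(\lambda)=D(\lambda)+C(\lambda)A(\lambda)^{-1}B(\lambda)$, for some nonsingular polynomial matrix $A(\lambda)\in\mathbb{F}[\lambda]^{n\times n}$ and polynomial matrices $B(\lambda)\in\mathbb{F}[\lambda]^{n\times m}$, $C(\lambda)\in\mathbb{F}[\lambda]^{p\times n}$ and $D(\lambda)\in\mathbb{F}[\lambda]^{p\times m}$. Let $L_A(\lambda)=\begin{bmatrix}M_A(\lambda)\\ K_A(\lambda)\end{bmatrix}$ and $L_D(\lambda)=\begin{bmatrix}M_D(\lambda)\\ K_D(\lambda)\end{bmatrix}$ be strong block minimal basis pencils associated with $A(\lambda)$ and $D(\lambda)$, respectively; let $N_A(\lambda)$ and $N_D(\lambda)$ be minimal bases dual to $K_A(\lambda)$ and $K_D(\lambda)$, respectively, each with all its row degrees equal, with $M_A(\lambda)N_A(\lambda)^T=A(\lambda)$ and $M_D(\lambda)N_D(\lambda)^T=D(\lambda)$, and let $\rho_A:=\deg N_A(\lambda)$, $\rho_D:=\deg N_D(\lambda)$. Let $M_C(\lambda)$ and $M_B(\lambda)$ be linear polynomial matrices such that $M_C(\lambda)N_A(\lambda)^T=C(\lambda)$ and $M_B(\lambda)N_D(\lambda)^T=B(\lambda)$. Consider the linear polynomial system matrix $$\mathcal{L}(\lambda)=\left[\begin{array}{c|c} M_A(\lambda) & M_B(\lambda)\\ K_A(\lambda) & 0\\ \hline -M_C(\lambda) & M_D(\lambda)\\ 0 &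 K_D(\lambda)\end{array}\right]\in\mathbb{F}[\lambda]^{(n+p+\rho_An+\rho_Dm)\times(n+m+\rho_An+\rho_Dm)},$$ with state matrix $L_A(\lambda)$, and let $\widehat R(\lambda)$ be its transfer function matrix. If $$\operatorname{rank}\begin{bmatrix}A(\lambda_0)&B(\lambda_0)\end{bmatrix}=n\ \text{ for all }\lambda_0\in\mathbb{F},\quad\text{and}\quad\operatorname{rank}\begin{bmatrix}\operatorname{rev}_{\rho_A+1}A(0)&\operatorname{rev}_{\rho_D+1}B(0)\end{bmatrix}=n,$$ then the following statements hold: (a) If $\{z_i(\lambda)^T\}_{i=1}^t$ is a left minimal basis of $\mathcal{L}(\lambda)$, then $z_i(\lambda)^T=\begin{bmatrix}y_i(\lambda)^T&x_i(\lambda)^T\end{bmatrix}$, for $i=1,\ldots,t$, for some left minimal basis $\{x_i(\lambda)^T\}_{i=1}^t$ of $\widehat R(\lambda)$ (with $y_i(\lambda)^T$ having $n+\rho_An$ entries and $x_i(\lambda)^T$ having $p+\rho_Dm$ entries), and $x_i(\lambda)^T=\begin{bmatrix}u_i(\lambda)^T&w_i(\lambda)^T\end{bmatrix}$, for $i=1,\ldots,t$, for some left minimal basis $\{u_i(\lambda)^T\}_{i=1}^t$ of $R(\lambda)$ (with $u_i(\lambda)^T$ having $p$ entries). (b) If $\eta_1\le\cdots\le\eta_t$ are the left minimal indices of $\mathcal{L}(\lambda)$, then $\eta_1\le\cdots\le\eta_t$ are the left minimal indices of $\widehat R(\lambda)$ and of $R(\lambda)$.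
   Context: $\mathbb{F}$ is an algebraically closed field (not including infinity); $\mathbb{F}[\lambda]$ and $\mathbb{F}(\lambda)$ are the polynomials and rational functions over $\mathbb{F}$. A rational matrix is regular if it is square with determinant not identically zero, and singular otherwise. A polynomial matrix is linear if all its entries have degree at most $1$. For an integer $g$ and a rational matrix $G(\lambda)$, $\operatorname{rev}_gG(\lambda):=\lambda^gG(1/\lambda)$, and $\operatorname{rev}_gG(0)$ means $\operatorname{rev}_gG(\lambda)$ evaluated at $\lambda=0$. Minimal bases and indices: a minimal basis of a subspace $\mathcal{V}$ of $\mathbb{F}(\lambda)^{N}$ is a basis of $\mathcal{V}$ consisting of polynomial vectors whose sum of degrees is minimal among all polynomial bases of $\mathcal{V}$; the ordered list of degrees of its vectors depends only on $\mathcal{V}$, and these degrees are the minimal indices of $\mathcal{V}$. The left minimal bases and left minimal indices of a rational matrix $G(\lambda)$ are those of its left nullspace $\mathcal{N}_\ell(G)=\{y(\lambda)^T\in\mathbb{F}(\lambda)^{1\times N}:y(\lambda)^TG(\lambda)=0\}$, where $N$ is the number of rows of $G$. A polynomial matrix with fewer rows than columns is called a minimal basis if its rows form a minimal basis of the subspace they span. Minimal bases $K(\lambda)\in\mathbb{F}[\lambda]^{k\times l}$ and $N(\lambda)\in\mathbb{F}[\lambda]^{q\times l}$ are dual if $k+q=l$ and $K(\lambda)N(\lambda)^T=0$. The $i$th row degree of a polynomial matrix is the degree of its $i$th row. Strong block minimal basis pencil (degenerate form, the only one used here): a linear polynomial matrix $\begin{bmatrix}M(\lambda)\\ K(\lambda)\end{bmatrix}$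 where $K(\lambda)$ is a minimal basis with all its row degrees equal to $1$ and the row degrees of a minimal basis $N(\lambda)$ dual to $K(\lambda)$ are all equal. It is associated with a polynomial matrix $P(\lambda)$ if $M(\lambda)N(\lambda)^T=P(\lambda)$. If $P(\lambda)$ has $c$ columns and $\rho=\deg N(\lambda)$, then $K(\lambda)$ has size $\rho c\times(\rho+1)c$. For polynomial matrices $\mathsf{A}$ (square and regular), $\mathsf{B},\mathsf{C},\mathsf{D}$ of compatible sizes, $\begin{bmatrix}\mathsf{A}(\lambda)&\mathsf{B}(\lambda)\\ -\mathsf{C}(\lambda)&\mathsf{D}(\lambda)\end{bmatrix}$ is a polynomial system matrix with state matrix $\mathsf{A}(\lambda)$ and transfer function matrix $\mathsf{D}(\lambda)+\mathsf{C}(\lambda)\mathsf{A}(\lambda)^{-1}\mathsf{B}(\lambda)$. For $\mathcal{L}(\lambda)$ in the claim, $\widehat R(\lambda)=\begin{bmatrix}M_D(\lambda)\\ K_D(\lambda)\end{bmatrix}+\begin{bmatrix}M_C(\lambda)\\ 0\end{bmatrix}L_A(\lambda)^{-1}\begin{bmatrix}M_B(\lambda)\\ 0\end{bmatrix}$. *)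

theory Defs
  imports
    "Jordan_Normal_Form.Matrix_Kernel"
    "Jordan_Normal_Form.DL_Rank"
    "Jordan_Normal_Form.Char_Poly"
    "HOL-Computational_Algebra.Polynomial_Factorial"
begin

abbreviation rat_mat :: "'a::field poly mat \<Rightarrow> 'a poly fract mat" where
  "rat_mat \<equiv> map_mat to_fract"

definition rat_const :: "'a::field \<Rightarrow> 'a poly fract" where
  "rat_const c = to_fract [:c:]"

definition rat_var :: "'a::field poly fract" where
  "rat_var = to_fract [:0, 1:]"

text \<open>
  Evaluation of a rational function at the point \<open>x\<close> of an extension field, \<open>h\<close> being the
  embedding of the coefficients.  It covers both the value at a scalar (\<open>h = id\<close>) and the
  substitution of a rational function for the variable (\<open>h = rat_const\<close>).  At a pole the value
  is unspecified; elsewhere it is well defined, see \<open>rat_eval_Fract\<close> below.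
\<close>

definition rat_eval :: "('a::field \<Rightarrow> 'b::field) \<Rightarrow> 'b \<Rightarrow> 'a poly fract \<Rightarrow> 'b" where
  "rat_eval h x r = (THE v. \<exists>a b. r = Fract a b \<and> poly (map_poly h b) x \<noteq> 0 \<and>
                             v = poly (map_poly h a) x / poly (map_poly h b) x)"

lemma rat_eval_Fract:
  assumes h: "field_hom h" and b: "poly (map_poly h b) x \<noteq> 0"
  shows "rat_eval h x (Fract a b) = poly (map_poly h a) x / poly (map_poly h b) x"
proof -
  interpret field_hom h by (rule h)
  interpret mp: map_poly_idom_hom h ..
  let ?e = "\<lambda>q. poly (map_poly h q) x"
  show ?thesis unfolding rat_eval_def
  proof (rule the_equality)
    fix v assume "\<exists>a' b'. Fract a b = Fract a' b' \<and> ?e b' \<noteq> 0 \<and> v = ?e a' / ?e b'"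
    then obtain a' b' where eq: "Fract a b = Fract a' b'" and b': "?e b' \<noteq> 0"
      and v: "v = ?e a' / ?e b'" by blast
    have "b \<noteq> 0" "b' \<noteq> 0" using b b' by auto
    with eq have "a * b' = a' * b" by (simp add: eq_fract)
    hence "?e (a * b') = ?e (a' * b)" by simp
    hence "?e a * ?e b' = ?e a' * ?e b" by (simp add: mp.hom_mult)
    thus "v = ?e a / ?e b" using b b' v by (simp add: frac_eq_eq)
  qed (use b in blast)
qed

definition rev_mat :: "int \<Rightarrow> 'a::field poly fract mat \<Rightarrow> 'a poly fract mat" where
  "rev_mat g G = map_mat (\<lambda>r. rat_var powi g * rat_eval rat_const (inverse rat_var) r) G"

definition eval_poly_mat :: "'a::field poly mat \<Rightarrow> 'a \<Rightarrow> 'a mat" where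
  "eval_poly_mat P x = map_mat (\<lambda>p. poly p x) P"

definition eval_rat_mat :: "'a::field poly fract mat \<Rightarrow> 'a \<Rightarrow> 'a mat" where
  "eval_rat_mat G x = map_mat (rat_eval id x) G"

lemma field_hom_rat_const: "field_hom (rat_const :: 'a::field \<Rightarrow> _)"
  by unfold_locales (simp_all add: rat_const_def flip: to_fract_add to_fract_mult one_pCons)

text \<open>For a polynomial of degree at most \<open>g\<close>, the value at 0 of its reversal is the coefficient of
  \<open>\<lambda>\<^sup>g\<close>.\<close>

lemma rev_poly_eval_0:
  fixes p :: "'a::field poly"
  assumes deg: "degree p \<le> g"
  shows "rat_eval id 0 (rat_var powi int g * rat_eval rat_const (inverse rat_var) (to_fract p))
         = coeff p g"
proof -
  interpret rc: field_hom "rat_const :: 'a \<Rightarrow> _" by (rule field_hom_rat_const)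
  let ?X = "rat_var :: 'a poly fract"
  define q where "q = (\<Sum>i\<le>degree p. monom (coeff p i) (g - i))"
  have X0: "?X \<noteq> 0" by (simp add: rat_var_def)
  have X_pow: "?X ^ k = to_fract (monom 1 k)" for k
    by (induction k)
       (simp_all add: rat_var_def monom_Suc monom_0 flip: to_fract_mult one_pCons)
  have "rat_eval rat_const (inverse ?X) (to_fract p) = poly (map_poly rat_const p) (inverse ?X)"
    using rat_eval_Fract[OF field_hom_rat_const, of 1 "inverse ?X" p]
    by (simp add: to_fract_def)
  also have "\<dots> = (\<Sum>i\<le>degree p. rat_const (coeff p i) * inverse ?X ^ i)"
    by (simp add: poly_altdef coeff_map_poly rc.degree_map_poly_hom)
  finally have "?X powi int g * rat_eval rat_const (inverse ?X) (to_fract p)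
      = (\<Sum>i\<le>degree p. rat_const (coeff p i) * (?X ^ g * inverse ?X ^ i))"
    by (simp add: sum_distrib_left mult_ac)
  also have "\<dots> = (\<Sum>i\<le>degree p. to_fract (monom (coeff p i) (g - i)))"
  proof (rule sum.cong[OF refl])
    fix i assume "i \<in> {..degree p}"
    hence "g = (g - i) + i" using deg by simp
    hence "?X ^ g = ?X ^ (g - i) * ?X ^ i" by (metis power_add)
    hence "?X ^ g * inverse ?X ^ i = ?X ^ (g - i)" using X0 by (simp add: power_inverse)
    thus "rat_const (coeff p i) * (?X ^ g * inverse ?X ^ i) = to_fract (monom (coeff p i) (g - i))"
      by (simp add: X_pow rat_const_def smult_monom flip: to_fract_mult)
  qed
  also have "\<dots> = to_fract q"
    unfolding q_def by (induction "degree p") (simp_all flip: to_fract_add)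
  finally have *: "?X powi int g * rat_eval rat_const (inverse ?X) (to_fract p) = to_fract q" .
  have hom_id: "field_hom (id :: 'a \<Rightarrow> 'a)" by unfold_locales auto
  have "rat_eval id 0 (to_fract q) = poly q 0"
    using rat_eval_Fract[OF hom_id, of 1 0 q] by (simp add: to_fract_def map_poly_id)
  also have "\<dots> = (\<Sum>i\<le>degree p. if i = g then coeff p i else 0)"
    unfolding q_def poly_sum using deg
    by (intro sum.cong) (auto simp: poly_monom)
  also have "\<dots> = coeff p g" using deg by (auto simp: coeff_eq_0)
  finally show ?thesis by (simp only: *)
qed

definition append_cols :: "'a::zero mat \<Rightarrow> 'a mat \<Rightarrow> 'a mat" where
  "append_cols A B = four_block_mat A B (0\<^sub>m 0 (dim_col A)) (0\<^sub>m 0 (dim_col B))"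

definition regular_mat :: "'a::comm_ring_1 mat \<Rightarrow> bool" where
  "regular_mat G \<longleftrightarrow> square_mat G \<and> det G \<noteq> 0"

abbreviation singular_mat :: "'a::comm_ring_1 mat \<Rightarrow> bool" where
  "singular_mat G \<equiv> \<not> regular_mat G"

definition linear_poly_mat :: "'a::zero poly mat \<Rightarrow> bool" where
  "linear_poly_mat P \<longleftrightarrow> (\<forall>i<dim_row P. \<forall>j<dim_col P. degree (P $$ (i, j)) \<le> 1)"

definition vec_degree :: "'a::zero poly vec \<Rightarrow> nat" where
  "vec_degree v = Max (insert 0 {degree (v $ i) | i. i < dim_vec v})"

abbreviation row_degree :: "'a::zero poly mat \<Rightarrow> nat \<Rightarrow> nat" where
  "row_degree P i \<equiv> vec_degree (row P i)"

definition equal_row_degrees :: "'a::zero poly mat \<Rightarrow> bool" where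
  "equal_row_degrees P \<longleftrightarrow>
     (\<forall>i<dim_row P. \<forall>j<dim_row P. row_degree P i = row_degree P j)"

definition mat_degree :: "'a::zero poly mat \<Rightarrow> nat" where
  "mat_degree P = Max (insert 0 {degree (P $$ (i, j)) | i j. i < dim_row P \<and> j < dim_col P})"

text \<open>
  Here and below \<open>V\<close> stands for a subspace of the vectors with \<open>N\<close> rational entries.  A basis is a
  list, so that its members can be matched by index with those of other bases.
\<close>

definition polynomial_basis ::
  "nat \<Rightarrow> 'a::field poly fract vec set \<Rightarrow> 'a poly vec list \<Rightarrow> bool" where
  "polynomial_basis N V vs \<longleftrightarrow> distinct vs \<and>
     vectorspace.basis class_ring ((module_vec TYPE('a poly fract) N)\<lparr>carrier := V\<rparr>)
       (map_vec to_fract ` set vs)"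

definition minimal_basis ::
  "nat \<Rightarrow> 'a::field poly fract vec set \<Rightarrow> 'a poly vec list \<Rightarrow> bool" where
  "minimal_basis N V vs \<longleftrightarrow> polynomial_basis N V vs \<and>
     (\<forall>ws. polynomial_basis N V ws \<longrightarrow>
        sum_list (map vec_degree vs) \<le> sum_list (map vec_degree ws))"

text \<open>
  A relation, since the independence of the minimal indices of the chosen minimal basis is a
  theorem.
\<close>

definition minimal_indices ::
  "nat \<Rightarrow> 'a::field poly fract vec set \<Rightarrow> nat list \<Rightarrow> bool" where
  "minimal_indices N V \<eta>s \<longleftrightarrow>
     (\<exists>vs. minimal_basis N V vs \<and> \<eta>s = sort (map vec_degree vs))"

text \<open>Row vectors \<open>y\<^sup>T\<close> with \<open>y\<^sup>T G = 0\<close> are represented by the vectors \<open>y\<close>.\<close>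

definition left_nullspace :: "'a::field poly fract mat \<Rightarrow> 'a poly fract vec set" where
  "left_nullspace G = mat_kernel (transpose_mat G)"

definition left_minimal_basis :: "'a::field poly fract mat \<Rightarrow> 'a poly vec list \<Rightarrow> bool" where
  "left_minimal_basis G = minimal_basis (dim_row G) (left_nullspace G)"

definition left_minimal_indices :: "'a::field poly fract mat \<Rightarrow> nat list \<Rightarrow> bool" where
  "left_minimal_indices G = minimal_indices (dim_row G) (left_nullspace G)"

definition minimal_basis_mat :: "'a::field poly mat \<Rightarrow> bool" where
  "minimal_basis_mat K \<longleftrightarrow> dim_row K < dim_col K \<and>
     minimal_basis (dim_col K) (vec_space.row_space (dim_col K) (rat_mat K)) (rows K)"

definition dual_minimal_bases :: "'a::field poly mat \<Rightarrow> 'a poly mat \<Rightarrow> bool" where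
  "dual_minimal_bases K N \<longleftrightarrow> minimal_basis_mat K \<and> minimal_basis_mat N \<and>
     dim_col N = dim_col K \<and> dim_row K + dim_row N = dim_col K \<and>
     K * transpose_mat N = 0\<^sub>m (dim_row K) (dim_row N)"

text \<open>The pencil is \<open>M @\<^sub>r K\<close>; the property depends on its partition into \<open>M\<close> and \<open>K\<close>.\<close>

definition strong_block_minimal_basis_pencil :: "'a::field poly mat \<Rightarrow> 'a poly mat \<Rightarrow> bool" where
  "strong_block_minimal_basis_pencil M K \<longleftrightarrow> dim_col M = dim_col K \<and>
     linear_poly_mat (M @\<^sub>r K) \<and> minimal_basis_mat K \<and> (\<forall>i<dim_row K. row_degree K i = 1) \<and>
     (\<exists>N. dual_minimal_bases K N \<and> equal_row_degrees N)"

definition polynomial_system_matrix ::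
  "'a::field poly mat \<Rightarrow> 'a poly mat \<Rightarrow> 'a poly mat \<Rightarrow> 'a poly mat \<Rightarrow> 'a poly mat" where
  "polynomial_system_matrix A B C D = four_block_mat A B (- C) D"

text \<open>Meaningful only for a regular state matrix \<open>A\<close>.\<close>

definition transfer_function ::
  "'a::field poly mat \<Rightarrow> 'a poly mat \<Rightarrow> 'a poly mat \<Rightarrow> 'a poly mat \<Rightarrow> 'a poly fract mat" where
  "transfer_function A B C D =
     rat_mat D + rat_mat C * the (mat_inverse (rat_mat A)) * rat_mat B"

end

theory Submission
  imports Defs
begin

text \<open>
  Split a vector of the left nullspace of \<open>L\<close> along the block rows as \<open>(y1, y2, u, w)\<close>. The whole
  theorem rests on one fact: the projection \<open>(y1, y2, u, w) \<mapsto> u\<close> is a linear bijection from the left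
  nullspace of \<open>L\<close> onto that of \<open>R\<close>, and between polynomial vectors it is a bijection that keeps
  degrees. Such a map carries polynomial bases to polynomial bases with the same degrees in both
  directions, hence minimal bases to minimal bases (\<open>minimal_basis_slice\<close>). The projection
  onto \<open>(u, w)\<close> lies between the two and inherits the property, which gives the statement
  for \<open>R_hat\<close>.

  Multiplying the defining equations of the left nullspace of \<open>L\<close> by \<open>N_A\<^sup>T\<close> and \<open>N_D\<^sup>T\<close> kills
  \<open>y2\<close> and \<open>w\<close> and leaves \<open>y1\<^sup>T A = u\<^sup>T C\<close> and \<open>y1\<^sup>T B + u\<^sup>T D = 0\<close> (\<open>compress\<close>), that is, \<open>u\<close> is in
  the left nullspace of \<open>R\<close>. Conversely, let \<open>u\<close> be a polynomial vector of degree \<open>d\<close> in the left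
  nullspace of \<open>R\<close>. The vector \<open>y1\<close> is determined by \<open>u\<close> over the rational functions.
  It is polynomial because \<open>[A B]\<close> has full row rank at every point, and
  its degree is at most \<open>d\<close> because \<open>[A B]\<close> has full row rank at infinity (\<open>lift_to_state\<close>). Next,
  \<open>y2\<close> has to satisfy \<open>y2\<^sup>T K_A = u\<^sup>T M_C - y1\<^sup>T M_A\<close>. The right-hand side is annihilated by
  \<open>N_A\<^sup>T\<close>, so it is in the row space of \<open>K_A\<close>, and it has degree at most \<open>d + 1\<close>. A minimal basis
  whose row degrees are all 1 has full row rank at every point and at infinity, so \<open>y2\<close> is again
  polynomial of degree at most \<open>d\<close> (\<open>dual_minimal_bases_lift\<close>). The vector \<open>w\<close> is found in the same
  way from \<open>K_D\<close> (\<open>lift_to_L\<close>).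

  The same two principles are used for \<open>[A B]\<close> and for \<open>K_A\<close>, \<open>K_D\<close>: full row rank at all points makes
  a rational preimage of a polynomial vector polynomial (\<open>polynomial_of_full_row_rank\<close>), and full row
  rank of the leading coefficients bounds its degree (\<open>vec_degree_of_full_row_rank\<close>).
\<close>

section \<open>Polynomial bases in coordinates\<close>

abbreviation rat_vec :: "'a::field poly vec \<Rightarrow> 'a poly fract vec" where
  "rat_vec \<equiv> map_vec to_fract"

lemma inj_on_mult_mat_vec_iff:
  fixes G :: "'a::ring_1 mat"
  assumes G: "G \<in> carrier_mat n k"
  shows "inj_on ((*\<^sub>v) G) (carrier_vec k) \<longleftrightarrow>
    (\<forall>c \<in> carrier_vec k. G *\<^sub>v c = 0\<^sub>v n \<longrightarrow> c = 0\<^sub>v k)"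
proof
  assume inj: "inj_on ((*\<^sub>v) G) (carrier_vec k)"
  show "\<forall>c \<in> carrier_vec k. G *\<^sub>v c = 0\<^sub>v n \<longrightarrow> c = 0\<^sub>v k"
  proof (intro ballI impI)
    fix c assume c: "c \<in> carrier_vec k" "G *\<^sub>v c = 0\<^sub>v n"
    have "G *\<^sub>v 0\<^sub>v k = 0\<^sub>v n" using G by auto
    with c inj show "c = 0\<^sub>v k" by (auto simp: inj_on_def)
  qed
next
  assume ker: "\<forall>c \<in> carrier_vec k. G *\<^sub>v c = 0\<^sub>v n \<longrightarrow> c = 0\<^sub>v k"
  show "inj_on ((*\<^sub>v) G) (carrier_vec k)"
  proof (rule inj_onI)
    fix c d assume c: "c \<in> carrier_vec k" and d: "d \<in> carrier_vec k" and eq: "G *\<^sub>v c = G *\<^sub>v d"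
    have "G *\<^sub>v (c - d) = G *\<^sub>v c - G *\<^sub>v d" using G c d by (simp add: mult_minus_distrib_mat_vec)
    also have "\<dots> = 0\<^sub>v n" using G d by (simp add: eq)
    finally have "c - d = 0\<^sub>v k" using ker c d by simp
    thus "c = d" using c d
      by (metis carrier_vecD eq_vecI index_minus_vec(1) index_zero_vec(1) right_minus_eq)
  qed
qed

text \<open>
  A repeated entry of \<open>fs\<close> makes the coordinate map non-injective, so injectivity covers both
  distinctness and independence. This lets bases be handled as lists, without coefficient
  functions on sets.
\<close>

lemma (in vec_space) lin_indpt_list_iff_inj_on:
  assumes fs: "set fs \<subseteq> carrier_vec n"
  shows "distinct fs \<and> lin_indpt (set fs) \<longleftrightarrow>
    inj_on ((*\<^sub>v) (mat_of_cols n fs)) (carrier_vec (length fs))"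
    (is "?L \<longleftrightarrow> ?R")
proof -
  let ?G = "mat_of_cols n fs" and ?k = "length fs"
  have G: "?G \<in> carrier_mat n ?k" by simp
  have cols: "cols ?G = fs" using fs by simp
  have dist: "distinct fs" if ?R
  proof (rule ccontr)
    assume "\<not> distinct fs"
    then obtain i j where ij: "i < ?k" "j < ?k" "i \<noteq> j" "fs ! i = fs ! j"
      by (auto simp: distinct_conv_nth)
    have "?G *\<^sub>v unit_vec ?k l = fs ! l" if l: "l < ?k" for l
    proof (rule eq_vecI)
      have "fs ! l \<in> carrier_vec n" using fs l by auto
      thus "dim_vec (?G *\<^sub>v unit_vec ?k l) = dim_vec (fs ! l)" by auto
      fix i assume "i < dim_vec (fs ! l)"
      hence i: "i < n" using \<open>fs ! l \<in> carrier_vec n\<close> by auto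
      thus "(?G *\<^sub>v unit_vec ?k l) $ i = fs ! l $ i"
        using l scalar_prod_right_unit[of l ?k "row ?G i"] by (simp add: mat_of_cols_index)
    qed
    with ij have "?G *\<^sub>v unit_vec ?k i = ?G *\<^sub>v unit_vec ?k j" by simp
    with that have "unit_vec ?k i = (unit_vec ?k j :: 'a vec)" by (auto dest!: inj_onD)
    hence "unit_vec ?k i $ i = (unit_vec ?k j :: 'a vec) $ i" by simp
    thus False using ij by simp
  qed
  show ?thesis
  proof
    assume L: ?L
    show ?R unfolding inj_on_mult_mat_vec_iff[OF G]
      using lin_depI[OF G] L cols by metis
  next
    assume R: ?R
    with dist have d: "distinct fs" by blast
    moreover have "lin_indpt (set fs)"
      using lin_depE[OF G] R[unfolded inj_on_mult_mat_vec_iff[OF G]] cols d by metis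
    ultimately show ?L by blast
  qed
qed

lemma (in vec_space) span_list_eq_image:
  assumes fs: "set fs \<subseteq> carrier_vec n"
  shows "span (set fs) = (*\<^sub>v) (mat_of_cols n fs) ` carrier_vec (length fs)"
proof -
  have "span (set fs) = col_space (mat_of_cols n fs)"
    using fs by (simp add: col_space_def)
  also have "\<dots> = (*\<^sub>v) (mat_of_cols n fs) ` carrier_vec (length fs)"
    by (auto simp: col_space_eq[of _ "length fs"] intro!: mult_mat_vec_carrier[of _ _ "length fs"])
  finally show ?thesis .
qed

text \<open>
  A list is a basis exactly if its coordinate map is a bijection onto the subspace. All later
  arguments about bases compose this map with another bijection: a projection of the subspace, or a
  change of coordinates.
\<close>

lemma polynomial_basis_iff:
  fixes V :: "'a::field poly fract vec set"
  assumes V: "submodule class_ring V (module_vec TYPE('a poly fract) N)"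
  shows "polynomial_basis N V vs \<longleftrightarrow> set vs \<subseteq> carrier_vec N \<and>
    bij_betw ((*\<^sub>v) (rat_mat (mat_of_cols N vs))) (carrier_vec (length vs)) V"
proof -
  interpret VS: vec_space "TYPE('a poly fract)" N .
  let ?fs = "map rat_vec vs" and ?W = "(module_vec TYPE('a poly fract) N)\<lparr>carrier := V\<rparr>"
  interpret W: vectorspace class_ring ?W
    by (rule VS.subspace_is_vs, rule subspace.intro[OF VS.vectorspace_axioms V])
  have inj: "inj rat_vec" by (auto simp: inj_def vec_eq_iff)
  have dist: "distinct ?fs \<longleftrightarrow> distinct vs" using inj by (metis distinct_map inj_on_subset subset_UNIV)
  have VN: "V \<subseteq> carrier_vec N" using V by (auto simp: submodule_def)
  have carr: "set ?fs \<subseteq> carrier_vec N \<longleftrightarrow> set vs \<subseteq> carrier_vec N" by auto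
  have mat: "mat_of_cols N ?fs = rat_mat (mat_of_cols N vs)" if "set vs \<subseteq> carrier_vec N"
    using that by (rule mat_of_cols_map)
  have sub: "W.span (set ?fs) = VS.span (set ?fs)" "W.lin_dep (set ?fs) = VS.lin_dep (set ?fs)"
    if "set ?fs \<subseteq> V"
    using VS.span_li_not_depend[OF that V] by simp_all
  have "polynomial_basis N V vs \<longleftrightarrow> distinct ?fs \<and> W.basis (set ?fs)"
    by (simp add: polynomial_basis_def dist)
  also have "\<dots> \<longleftrightarrow> set ?fs \<subseteq> V \<and> distinct ?fs \<and> VS.lin_indpt (set ?fs) \<and> VS.span (set ?fs) = V"
    unfolding W.basis_def using sub by auto
  also have "\<dots> \<longleftrightarrow> set ?fs \<subseteq> carrier_vec N \<and> distinct ?fs \<and> VS.lin_indpt (set ?fs) \<and> VS.span (set ?fs) = V"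
    using VN VS.in_own_span[of "set ?fs"] by auto
  also have "\<dots> \<longleftrightarrow> set vs \<subseteq> carrier_vec N \<and>
    bij_betw ((*\<^sub>v) (rat_mat (mat_of_cols N vs))) (carrier_vec (length vs)) V"
    unfolding bij_betw_def carr
    using VS.lin_indpt_list_iff_inj_on[of ?fs] VS.span_list_eq_image[of ?fs] mat carr by auto
  finally show ?thesis .
qed

lemma submodule_vecD:
  fixes V :: "'a::field vec set"
  assumes "submodule class_ring V (module_vec TYPE('a) N)"
  shows "V \<subseteq> carrier_vec N"
    and "v \<in> V \<Longrightarrow> w \<in> V \<Longrightarrow> v + w \<in> V"
    and "v \<in> V \<Longrightarrow> a \<cdot>\<^sub>v v \<in> V"
    and "v \<in> V \<Longrightarrow> w \<in> V \<Longrightarrow> v - w \<in> V"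
proof -
  show VN: "V \<subseteq> carrier_vec N" and add: "v \<in> V \<Longrightarrow> w \<in> V \<Longrightarrow> v + w \<in> V"
    and smult: "v \<in> V \<Longrightarrow> a \<cdot>\<^sub>v v \<in> V" for v w a
    using assms by (auto simp: submodule_def module_vec_simps class_ring_simps)
  show "v - w \<in> V" if "v \<in> V" "w \<in> V"
  proof -
    have "v - w = v + (-1) \<cdot>\<^sub>v w" using that VN by (intro eq_vecI) auto
    thus ?thesis using add[OF that(1) smult[OF that(2), of "-1"]] by simp
  qed
qed

lemma submodule_mat_kernel:
  fixes A :: "'a::field mat"
  assumes "A \<in> carrier_mat nr nc"
  shows "submodule class_ring (mat_kernel A) (module_vec TYPE('a) nc)"
proof -
  have zero: "a \<cdot>\<^sub>v 0\<^sub>v nr = 0\<^sub>v nr" for a :: 'a by (intro eq_vecI) auto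
  have "v + w \<in> mat_kernel A" "a \<cdot>\<^sub>v v \<in> mat_kernel A"
    if "v \<in> mat_kernel A" "w \<in> mat_kernel A" for v w a
    using that by (simp_all add: mat_kernel[OF assms] mult_add_distrib_mat_vec[OF assms] mult_mat_vec[OF assms] zero)
  moreover have "0\<^sub>v nc \<in> mat_kernel A" using assms by (intro mat_kernelI[OF assms] eq_vecI) auto
  ultimately show ?thesis
    by (intro submodule.intro vec_module)
      (auto simp: module_vec_simps class_ring_simps mat_kernel_carrier[OF assms, THEN subsetD])
qed

lemma submodule_left_nullspace:
  fixes G :: "'a::field poly fract mat"
  shows "submodule class_ring (left_nullspace G) (module_vec TYPE('a poly fract) (dim_row G))"
  unfolding left_nullspace_def by (rule submodule_mat_kernel[of _ "dim_col G"]) auto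

section \<open>Projections that preserve degrees\<close>

lemma vec_degree_le_iff: "vec_degree v \<le> d \<longleftrightarrow> (\<forall>i<dim_vec v. degree (v $ i) \<le> d)"
proof -
  have "{degree (v $ i) | i. i < dim_vec v} = (\<lambda>i. degree (v $ i)) ` {..<dim_vec v}" by auto
  thus ?thesis by (auto simp: vec_degree_def)
qed

lemma degree_le_vec_degree: "i < dim_vec v \<Longrightarrow> degree (v $ i) \<le> vec_degree v"
  using vec_degree_le_iff by blast

text \<open>
  Reduces questions about rational vectors of a subspace to its polynomial vectors.
\<close>

lemma common_denominator:
  fixes y :: "'a::field poly fract vec"
  shows "\<exists>q \<noteq> 0. \<exists>y' \<in> carrier_vec (dim_vec y). to_fract q \<cdot>\<^sub>v y = rat_vec y'"
proof -
  let ?n = "dim_vec y"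
  have "\<exists>a b. b \<noteq> 0 \<and> y $ i * to_fract b = to_fract a" for i
  proof (cases "y $ i" rule: Fract_cases)
    case (Fract a b)
    thus ?thesis
      by (intro exI[of _ a] exI[of _ b]) (simp add: to_fract_def eq_fract)
  qed
  then obtain a b where b0: "b i \<noteq> 0" and y: "y $ i * to_fract (b i) = to_fract (a i)" for i
    by metis
  define q where "q = (\<Prod>i<?n. b i)"
  define y' where "y' = vec ?n (\<lambda>i. a i * (\<Prod>j\<in>{..<?n} - {i}. b j))"
  have "q \<noteq> 0" using b0 by (simp add: q_def)
  moreover have "to_fract q \<cdot>\<^sub>v y = rat_vec y'"
  proof (rule eq_vecI)
    fix i assume "i < dim_vec (rat_vec y')"
    hence i: "i < ?n" by (simp add: y'_def)
    have "q = b i * (\<Prod>j\<in>{..<?n} - {i}. b j)"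
      using i unfolding q_def by (intro prod.remove) auto
    hence "to_fract q * y $ i = (y $ i * to_fract (b i)) * to_fract (\<Prod>j\<in>{..<?n} - {i}. b j)" by simp
    thus "(to_fract q \<cdot>\<^sub>v y) $ i = rat_vec y' $ i"
      using i by (simp add: y y'_def)
  qed (simp add: y'_def)
  ultimately show ?thesis by (intro exI[of _ q] conjI bexI[of _ y']) (auto simp: y'_def)
qed

definition vec_slice :: "nat \<Rightarrow> nat \<Rightarrow> 'a vec \<Rightarrow> 'a vec" where
  "vec_slice k M v = vec M (\<lambda>i. v $ (k + i))"

lemma vec_slice_carrier [simp]: "vec_slice k M v \<in> carrier_vec M" "dim_vec (vec_slice k M v) = M"
  by (simp_all add: vec_slice_def)

lemma vec_slice_index [simp]: "i < M \<Longrightarrow> vec_slice k M v $ i = v $ (k + i)"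
  by (simp add: vec_slice_def)

lemma vec_slice_rat_vec: "k + M \<le> dim_vec v \<Longrightarrow> vec_slice k M (rat_vec v) = rat_vec (vec_slice k M v)"
  by (intro eq_vecI) auto

lemma vec_degree_slice_le: "k + M \<le> dim_vec v \<Longrightarrow> vec_degree (vec_slice k M v) \<le> vec_degree v"
  by (auto simp: vec_degree_le_iff intro: degree_le_vec_degree)

lemma vec_slice_mult_mat_vec:
  fixes vs :: "'a::field poly vec list"
  assumes vs: "set vs \<subseteq> carrier_vec N" and k: "k + M \<le> N" and c: "c \<in> carrier_vec (length vs)"
  shows "vec_slice k M (rat_mat (mat_of_cols N vs) *\<^sub>v c) =
    rat_mat (mat_of_cols M (map (vec_slice k M) vs)) *\<^sub>v c"
proof (rule eq_vecI)
  fix i assume "i < dim_vec (rat_mat (mat_of_cols M (map (vec_slice k M) vs)) *\<^sub>v c)"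
  hence i: "i < M" by simp
  have "row (rat_mat (mat_of_cols N vs)) (k + i) = row (rat_mat (mat_of_cols M (map (vec_slice k M) vs))) i"
    using i k by (intro eq_vecI) (auto simp: mat_of_cols_index)
  thus "vec_slice k M (rat_mat (mat_of_cols N vs) *\<^sub>v c) $ i
      = (rat_mat (mat_of_cols M (map (vec_slice k M) vs)) *\<^sub>v c) $ i"
    using i k by simp
qed simp

lemma polynomial_basis_in:
  fixes V :: "'a::field poly fract vec set"
  assumes "submodule class_ring V (module_vec TYPE('a poly fract) N)" "polynomial_basis N V vs"
  shows "set vs \<subseteq> carrier_vec N" "rat_vec ` set vs \<subseteq> V"
proof -
  interpret VS: vec_space "TYPE('a poly fract)" N .
  show "set vs \<subseteq> carrier_vec N" using assms polynomial_basis_iff by blast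
  interpret W: vectorspace class_ring "(module_vec TYPE('a poly fract) N)\<lparr>carrier := V\<rparr>"
    by (rule VS.subspace_is_vs, rule subspace.intro[OF VS.vectorspace_axioms assms(1)])
  show "rat_vec ` set vs \<subseteq> V" using assms(2) by (simp add: polynomial_basis_def W.basis_def)
qed

text \<open>
  The situation in which minimal bases are transferred: cutting out the entries \<open>k, \<dots>, k + M - 1\<close> maps
  \<open>V\<close> injectively into \<open>W\<close>, and every polynomial vector of \<open>W\<close> comes from a polynomial
  vector of \<open>V\<close> of no larger degree. Surjectivity onto the rational vectors of \<open>W\<close> follows by
  clearing denominators.
\<close>

locale degree_preserving_slice =
  fixes N M k :: nat and V W :: "'a::field poly fract vec set"
  assumes V: "submodule class_ring V (module_vec TYPE('a poly fract) N)"
    and W: "submodule class_ring W (module_vec TYPE('a poly fract) M)"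
    and kM: "k + M \<le> N"
    and slice_in: "v \<in> V \<Longrightarrow> vec_slice k M v \<in> W"
    and slice_0: "v \<in> V \<Longrightarrow> vec_slice k M v = 0\<^sub>v M \<Longrightarrow> v = 0\<^sub>v N"
    and lift: "w \<in> carrier_vec M \<Longrightarrow> rat_vec w \<in> W \<Longrightarrow>
      \<exists>v \<in> carrier_vec N. rat_vec v \<in> V \<and> vec_slice k M v = w \<and> vec_degree v \<le> vec_degree w"
begin

lemma slice_bij: "bij_betw (vec_slice k M) V W"
proof (rule bij_betw_imageI)
  note VN = submodule_vecD(1)[OF V]
  show "inj_on (vec_slice k M) V"
  proof (rule inj_onI)
    fix v w assume v: "v \<in> V" and w: "w \<in> V" and eq: "vec_slice k M v = vec_slice k M w"
    from v w VN have dim: "dim_vec v = N" "dim_vec w = N" by auto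
    have "v $ (k + i) = w $ (k + i)" if "i < M" for i
      using arg_cong[OF eq, of "\<lambda>x. x $ i"] that by simp
    hence "vec_slice k M (v - w) = 0\<^sub>v M" using kM dim by (intro eq_vecI) auto
    hence "v - w = 0\<^sub>v N" using slice_0 submodule_vecD(4)[OF V v w] by blast
    thus "v = w" using v w VN
      by (metis carrier_vecD eq_vecI dim index_minus_vec(1) index_zero_vec(1) right_minus_eq)
  qed
  show "vec_slice k M ` V = W"
  proof (intro equalityI subsetI)
    fix w assume w: "w \<in> W"
    hence dim: "dim_vec w = M" using submodule_vecD(1)[OF W] by auto
    obtain q w' where q: "q \<noteq> 0" and w': "w' \<in> carrier_vec M" and qw: "to_fract q \<cdot>\<^sub>v w = rat_vec w'"
      using common_denominator[of w] dim by auto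
    have "rat_vec w' \<in> W" using submodule_vecD(3)[OF W w, of "to_fract q"] qw by simp
    then obtain v where v: "v \<in> carrier_vec N" "rat_vec v \<in> V" "vec_slice k M v = w'"
      using lift w' by blast
    let ?v = "(1 / to_fract q) \<cdot>\<^sub>v rat_vec v"
    have "vec_slice k M ?v = w"
    proof (rule eq_vecI)
      fix i assume "i < dim_vec w"
      hence i: "i < M" by (simp add: dim)
      have "to_fract q * w $ i = to_fract (v $ (k + i))"
        using arg_cong[OF qw, of "\<lambda>x. x $ i"] v i dim by auto
      thus "vec_slice k M ?v $ i = w $ i" using i v kM q by (simp add: field_simps)
    qed (simp add: dim)
    moreover have "?v \<in> V" using submodule_vecD(3)[OF V v(2)] .
    ultimately show "w \<in> vec_slice k M ` V" by blast
  qed (use slice_in in blast)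
qed

text \<open>
  The degree cannot grow under the projection; it cannot drop either, because by injectivity the
  vector itself is the only candidate for the lift.
\<close>

lemma vec_degree_slice:
  assumes v: "v \<in> carrier_vec N" "rat_vec v \<in> V"
  shows "vec_degree (vec_slice k M v) = vec_degree v"
proof (rule antisym)
  show "vec_degree (vec_slice k M v) \<le> vec_degree v" 
    by (rule vec_degree_slice_le) (use v kM in simp)
  have "rat_vec (vec_slice k M v) \<in> W" using slice_in[OF v(2)] v(1) kM by (simp add: vec_slice_rat_vec)
  then obtain v' where v': "v' \<in> carrier_vec N" "rat_vec v' \<in> V" "vec_slice k M v' = vec_slice k M v"
    "vec_degree v' \<le> vec_degree (vec_slice k M v)"
    using lift by (metis vec_slice_carrier(1))
  have "vec_slice k M (rat_vec v') = vec_slice k M (rat_vec v)"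
    using v v' kM by (simp add: vec_slice_rat_vec)
  hence "rat_vec v' = rat_vec v" using slice_bij v(2) v'(2) by (auto simp: bij_betw_def dest: inj_onD)
  hence "v' = v" by (auto simp: vec_eq_iff)
  with v' show "vec_degree v \<le> vec_degree (vec_slice k M v)" by simp
qed

lemma polynomial_basis_slice_iff:
  assumes vs: "set vs \<subseteq> carrier_vec N" "rat_vec ` set vs \<subseteq> V"
  shows "polynomial_basis M W (map (vec_slice k M) vs) \<longleftrightarrow> polynomial_basis N V vs"
proof -
  interpret VS: vec_space "TYPE('a poly fract)" N .
  let ?G = "rat_mat (mat_of_cols N vs)" and ?H = "rat_mat (mat_of_cols M (map (vec_slice k M) vs))"
  let ?C = "carrier_vec (length vs) :: 'a poly fract vec set"
  have "VS.span (set (map rat_vec vs)) \<subseteq> V" by (rule VS.span_is_subset) (use vs V in auto)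
  moreover have "mat_of_cols N (map rat_vec vs) = ?G" using vs(1) by (rule mat_of_cols_map)
  moreover have "set (map rat_vec vs) \<subseteq> carrier_vec N" using vs by auto
  ultimately have "(*\<^sub>v) ?G ` ?C \<subseteq> V" using VS.span_list_eq_image[of "map rat_vec vs"] by simp
  hence "bij_betw ((*\<^sub>v) ?G) ?C V \<longleftrightarrow> bij_betw (vec_slice k M \<circ> (*\<^sub>v) ?G) ?C W"
    by (rule bij_betw_comp_iff2[OF slice_bij])
  also have "\<dots> \<longleftrightarrow> bij_betw ((*\<^sub>v) ?H) ?C W"
    by (rule bij_betw_cong) (simp add: vec_slice_mult_mat_vec[OF vs(1) kM])
  finally show ?thesis unfolding polynomial_basis_iff[OF V] polynomial_basis_iff[OF W]
    using vs by auto
qed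

lemma map_vec_degree_slice:
  assumes "set vs \<subseteq> carrier_vec N" "rat_vec ` set vs \<subseteq> V"
  shows "map vec_degree (map (vec_slice k M) vs) = map vec_degree vs"
  using assms vec_degree_slice by auto

text \<open>
  Any competing polynomial basis of \<open>W\<close> lifts to one of \<open>V\<close> with the same degrees, so minimality in \<open>V\<close>
  implies minimality in \<open>W\<close>.
\<close>

theorem minimal_basis_slice:
  assumes min: "minimal_basis N V vs"
  shows "minimal_basis M W (map (vec_slice k M) vs)"
    and "map vec_degree (map (vec_slice k M) vs) = map vec_degree vs"
proof -
  have basis: "polynomial_basis N V vs" using min by (simp add: minimal_basis_def)
  note vs = polynomial_basis_in[OF V basis]
  show deg: "map vec_degree (map (vec_slice k M) vs) = map vec_degree vs"
    by (rule map_vec_degree_slice[OF vs])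
  show "minimal_basis M W (map (vec_slice k M) vs)" unfolding minimal_basis_def
  proof (intro conjI allI impI)
    show "polynomial_basis M W (map (vec_slice k M) vs)"
      using polynomial_basis_slice_iff[OF vs] basis by simp
    fix ws assume ws: "polynomial_basis M W ws"
    define lft where "lft w = (SOME v. v \<in> carrier_vec N \<and> rat_vec v \<in> V \<and> vec_slice k M v = w)" for w
    have lft: "lft w \<in> carrier_vec N \<and> rat_vec (lft w) \<in> V \<and> vec_slice k M (lft w) = w"
      if "w \<in> set ws" for w
      unfolding lft_def by (rule someI_ex) (use lift polynomial_basis_in[OF W ws] that in blast)
    have eq: "map (vec_slice k M) (map lft ws) = ws" using lft by (simp add: map_idI)
    have lws: "set (map lft ws) \<subseteq> carrier_vec N" "rat_vec ` set (map lft ws) \<subseteq> V" using lft by auto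
    have "polynomial_basis N V (map lft ws)"
      using polynomial_basis_slice_iff[OF lws] ws eq by simp
    hence "sum_list (map vec_degree vs) \<le> sum_list (map vec_degree (map lft ws))"
      using min by (auto simp: minimal_basis_def)
    also have "map vec_degree (map lft ws) = map vec_degree ws"
      using map_vec_degree_slice[OF lws] unfolding eq by (rule sym)
    finally show "sum_list (map vec_degree (map (vec_slice k M) vs)) \<le> sum_list (map vec_degree ws)"
      unfolding deg .
  qed
qed

end

section \<open>Full row rank at all points and at infinity\<close>

text \<open>
  Stated through the left kernel, so that it can be applied to a vector of coefficients directly.
\<close>

definition full_row_rank :: "'a::ring_1 mat \<Rightarrow> bool" where
  "full_row_rank G \<longleftrightarrow>
     (\<forall>c \<in> carrier_vec (dim_row G). transpose_mat G *\<^sub>v c = 0\<^sub>v (dim_col G) \<longrightarrow> c = 0\<^sub>v (dim_row G))"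

lemma rat_mult_mat_vec:
  fixes A :: "'a::field poly mat"
  assumes "A \<in> carrier_mat nr n" "v \<in> carrier_vec n"
  shows "rat_vec (A *\<^sub>v v) = rat_mat A *\<^sub>v rat_vec v"
proof -
  interpret semiring_hom "to_fract :: 'a poly \<Rightarrow> _" by unfold_locales auto
  show ?thesis by (rule mult_mat_vec_hom[OF assms])
qed

lemma rat_mat_mult:
  fixes A :: "'a::field poly mat"
  assumes "A \<in> carrier_mat nr n" "B \<in> carrier_mat n nc"
  shows "rat_mat (A * B) = rat_mat A * rat_mat B"
proof -
  interpret semiring_hom "to_fract :: 'a poly \<Rightarrow> _" by unfold_locales auto
  show ?thesis by (rule mat_hom_mult[OF assms])
qed

lemma rat_vec_eq_iff [simp]: "rat_vec v = rat_vec w \<longleftrightarrow> v = w"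
  by (auto simp: vec_eq_iff)

lemma rat_vec_smult: "rat_vec (q \<cdot>\<^sub>v v) = to_fract q \<cdot>\<^sub>v rat_vec v"
  by (intro eq_vecI) auto

lemma eval_mult_mat_vec:
  fixes A :: "'a::field poly mat"
  assumes "A \<in> carrier_mat nr n" "v \<in> carrier_vec n"
  shows "map_vec (\<lambda>p. poly p x) (A *\<^sub>v v) = eval_poly_mat A x *\<^sub>v map_vec (\<lambda>p. poly p x) v"
proof -
  have "semiring_hom (\<lambda>p::'a poly. poly p x)" by unfold_locales
  thus ?thesis unfolding eval_poly_mat_def by (rule semiring_hom.mult_mat_vec_hom[OF _ assms])
qed

text \<open>
  Write \<open>y\<close> with a denominator \<open>q\<close>. At a root of \<open>q\<close> the numerator vector lies in the left kernel of
  \<open>G\<close> evaluated there, so it vanishes, and the root cancels. Repeating this removes all of \<open>q\<close>.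
\<close>

theorem polynomial_of_full_row_rank:
  fixes G :: "'a::alg_closed_field poly mat"
  assumes G: "G \<in> carrier_mat n l"
    and rank: "\<And>x. full_row_rank (eval_poly_mat G x)"
    and y: "y \<in> carrier_vec n"
    and b: "transpose_mat (rat_mat G) *\<^sub>v y = rat_vec b"
  shows "\<exists>y' \<in> carrier_vec n. y = rat_vec y'"
proof -
  have GT: "transpose_mat G \<in> carrier_mat l n" using G by simp
  have dim_b: "dim_vec b = l" using arg_cong[OF b, of dim_vec] G by simp
  have "\<exists>y' \<in> carrier_vec n. y = rat_vec y'"
    if "q \<noteq> 0" "y0 \<in> carrier_vec n" "to_fract q \<cdot>\<^sub>v y = rat_vec y0" for q y0
    using that
  proof (induction "degree q" arbitrary: q y0 rule: less_induct)
    case less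
    show ?case
    proof (cases "degree q = 0")
      case True
      then obtain c where c: "q = [:c:]" by (metis degree_eq_zeroE)
      with less have "c \<noteq> 0" by auto
      hence inv: "to_fract [:1/c:] * to_fract q = 1" by (simp add: c flip: to_fract_mult one_pCons)
      have "rat_vec ([:1/c:] \<cdot>\<^sub>v y0) = to_fract [:1/c:] \<cdot>\<^sub>v (to_fract q \<cdot>\<^sub>v y)"
        unfolding rat_vec_smult less.prems(3) ..
      also have "\<dots> = y" unfolding smult_smult_assoc inv by (intro eq_vecI) auto
      finally show ?thesis using less.prems(2) by (metis smult_carrier_vec)
    next
      case False
      then obtain x where "poly q x = 0" using alg_closed_imp_poly_has_root by blast
      then obtain q' where q': "q = [:-x,1:] * q'" by (auto simp: poly_eq_0_iff_dvd)
      with less.prems have q'0: "q' \<noteq> 0" by auto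
      hence deg: "degree q' < degree q" unfolding q' by (subst degree_mult_eq) auto
      let ?e = "map_vec (\<lambda>p. poly p x)"
      have "rat_vec (transpose_mat G *\<^sub>v y0) = transpose_mat (rat_mat G) *\<^sub>v (to_fract q \<cdot>\<^sub>v y)"
        unfolding less.prems(3) using rat_mult_mat_vec[OF GT less.prems(2)] by (simp add: map_mat_transpose)
      also have "\<dots> = rat_vec (q \<cdot>\<^sub>v b)"
        using G y b by (simp add: mult_mat_vec[of _ l n] rat_vec_smult)
      finally have "transpose_mat G *\<^sub>v y0 = q \<cdot>\<^sub>v b" by simp
      hence "eval_poly_mat (transpose_mat G) x *\<^sub>v ?e y0 = ?e (q \<cdot>\<^sub>v b)"
        by (metis eval_mult_mat_vec GT less.prems(2))
      also have "\<dots> = 0\<^sub>v l" using dim_b by (intro eq_vecI) (auto simp: q')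
      finally have "transpose_mat (eval_poly_mat G x) *\<^sub>v ?e y0 = 0\<^sub>v l"
        by (simp add: eval_poly_mat_def map_mat_transpose)
      moreover have "dim_row (eval_poly_mat G x) = n" "dim_col (eval_poly_mat G x) = l"
        using G by (simp_all add: eval_poly_mat_def)
      ultimately have e0: "?e y0 = 0\<^sub>v n"
        using rank[of x] less.prems(2) unfolding full_row_rank_def by simp
      have "[:-x,1:] dvd y0 $ i" if "i < n" for i
        using arg_cong[OF e0, of "\<lambda>v. v $ i"] that less.prems(2) by (simp add: poly_eq_0_iff_dvd)
      then obtain w where w: "\<And>i. i < n \<Longrightarrow> y0 $ i = [:-x,1:] * w i" unfolding dvd_def by metis
      have "to_fract q' \<cdot>\<^sub>v y = rat_vec (vec n w)"
      proof (rule eq_vecI)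
        fix i assume "i < dim_vec (rat_vec (vec n w))"
        hence i: "i < n" by simp
        have "to_fract q * y $ i = to_fract (y0 $ i)"
          using arg_cong[OF less.prems(3), of "\<lambda>v. v $ i"] i y less.prems(2) by simp
        hence "to_fract [:-x,1:] * (to_fract q' * y $ i) = to_fract [:-x,1:] * to_fract (w i)"
          by (simp only: q' w[OF i] to_fract_mult mult.assoc)
        moreover have "to_fract [:-x,1:] \<noteq> 0" by simp
        ultimately have "to_fract q' * y $ i = to_fract (w i)" by (metis mult_cancel_left)
        thus "(to_fract q' \<cdot>\<^sub>v y) $ i = rat_vec (vec n w) $ i" using i y by simp
      qed (use y in simp)
      thus ?thesis by (rule less.hyps[OF deg q'0, rotated]) simp
    qed
  qed
  thus ?thesis using common_denominator[of y] y by auto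
qed

text \<open>
  With \<open>g j\<close> a bound for the degrees in column \<open>j\<close>, this is the value at infinity of \<open>G\<close> after each
  column \<open>j\<close> is divided by \<open>\<lambda> ^ g j\<close>.
\<close>

definition coeff_mat :: "(nat \<Rightarrow> nat) \<Rightarrow> 'a::zero poly mat \<Rightarrow> 'a mat" where
  "coeff_mat g G = mat (dim_row G) (dim_col G) (\<lambda>(i, j). coeff (G $$ (i, j)) (g j))"

lemma coeff_mult_degree_le:
  fixes p q :: "'a::comm_semiring_1 poly"
  assumes p: "degree p \<le> a" and q: "degree q \<le> b"
  shows "coeff (p * q) (a + b) = coeff p a * coeff q b"
proof -
  have "coeff (p * q) (a + b) = (\<Sum>i\<le>a+b. if i = a then coeff p a * coeff q b else 0)"
    unfolding coeff_mult
  proof (rule sum.cong[OF refl])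
    fix i assume i: "i \<in> {..a+b}"
    consider "i < a" | "i = a" | "i > a" by linarith
    thus "coeff p i * coeff q (a + b - i) = (if i = a then coeff p a * coeff q b else 0)"
    proof cases
      case 1
      hence "degree q < a + b - i" using q by linarith
      thus ?thesis using 1 by (simp add: coeff_eq_0)
    next
      case 3
      hence "degree p < i" using p by linarith
      thus ?thesis using 3 by (simp add: coeff_eq_0)
    qed simp
  qed
  thus ?thesis by simp
qed

text \<open>
  The coefficient of \<open>\<lambda>\<close> to the power \<open>e + g j\<close> in column \<open>j\<close> of the product, where \<open>e\<close> is the degree
  of \<open>y\<close>, is obtained by multiplying the leading coefficient vector of \<open>y\<close> with the leading
  coefficients of that column. If \<open>e > d\<close>, all these coefficients vanish and the leading coefficient
  vector of \<open>y\<close> would be zero.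
\<close>

theorem vec_degree_of_full_row_rank:
  fixes G :: "'a::field poly mat"
  assumes G: "G \<in> carrier_mat n l"
    and degG: "\<And>i j. i < n \<Longrightarrow> j < l \<Longrightarrow> degree (G $$ (i, j)) \<le> g j"
    and rank: "full_row_rank (coeff_mat g G)"
    and y: "y \<in> carrier_vec n"
    and deg: "\<And>j. j < l \<Longrightarrow> degree ((transpose_mat G *\<^sub>v y) $ j) \<le> d + g j"
  shows "vec_degree y \<le> d"
proof (rule ccontr)
  let ?e = "vec_degree y"
  assume "\<not> vec_degree y \<le> d"
  hence ed: "?e > d" by simp
  let ?c = "vec n (\<lambda>i. coeff (y $ i) ?e)"
  have "transpose_mat (coeff_mat g G) *\<^sub>v ?c = 0\<^sub>v l"
  proof (rule eq_vecI)
    fix j assume "j < dim_vec (0\<^sub>v l :: 'a vec)"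
    hence j: "j < l" by simp
    have "(transpose_mat (coeff_mat g G) *\<^sub>v ?c) $ j
        = (\<Sum>i<n. coeff (G $$ (i, j)) (g j) * coeff (y $ i) ?e)"
      using j G by (auto simp: coeff_mat_def scalar_prod_def atLeast0LessThan intro!: sum.cong)
    also have "\<dots> = (\<Sum>i<n. coeff (G $$ (i, j) * y $ i) (g j + ?e))"
      using j degG y by (intro sum.cong refl coeff_mult_degree_le[symmetric]) (auto intro: degree_le_vec_degree)
    also have "\<dots> = coeff ((transpose_mat G *\<^sub>v y) $ j) (g j + ?e)"
      using j G y by (auto simp: scalar_prod_def atLeast0LessThan coeff_sum intro!: sum.cong)
    also have "\<dots> = 0" using deg[OF j] ed by (intro coeff_eq_0) linarith
    finally show "(transpose_mat (coeff_mat g G) *\<^sub>v ?c) $ j = 0\<^sub>v l $ j" using j by simp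
  qed (use G in \<open>simp add: coeff_mat_def\<close>)
  moreover have "dim_row (coeff_mat g G) = n" "dim_col (coeff_mat g G) = l"
    using G by (simp_all add: coeff_mat_def)
  ultimately have c0: "?c = 0\<^sub>v n" using rank unfolding full_row_rank_def by simp
  have "degree (y $ i) \<le> ?e - 1" if i: "i < n" for i
  proof -
    have "coeff (y $ i) ?e = 0" using arg_cong[OF c0, of "\<lambda>v. v $ i"] i by simp
    moreover have "degree (y $ i) \<le> ?e" using i y by (auto intro: degree_le_vec_degree)
    ultimately show ?thesis using ed
      by (metis Suc_pred' bot_nat_0.not_eq_extremum leading_coeff_0_iff le_Suc_eq degree_0 not_less0 zero_le)
  qed
  \<comment> \<open>The subtraction is not truncated, because \<open>?e > d\<close>.\<close>
  hence "?e \<le> ?e - 1" using y by (auto simp: vec_degree_le_iff)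
  thus False using ed by simp
qed

section \<open>Minimal bases with row degrees one and their duals\<close>

text \<open>
  Replacing a basis vector by a polynomial vector that involves it gives another polynomial basis, so
  the new vector cannot have a smaller degree than the one that it replaces.
\<close>

lemma minimal_basis_exchange:
  fixes V :: "'a::field poly fract vec set"
  assumes V: "submodule class_ring V (module_vec TYPE('a poly fract) N)"
    and min: "minimal_basis N V vs"
    and c: "c \<in> carrier_vec (length vs)"
    and v: "v \<in> carrier_vec N" "rat_mat (mat_of_cols N vs) *\<^sub>v c = rat_vec v"
    and i: "i < length vs" "c $ i \<noteq> 0"
  shows "vec_degree (vs ! i) \<le> vec_degree v"
proof -
  let ?k = "length vs" and ?ws = "vs[i := v]"
  let ?G = "rat_mat (mat_of_cols N vs)" and ?H = "rat_mat (mat_of_cols N ?ws)"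
  let ?C = "carrier_vec ?k :: 'a poly fract vec set"
  \<comment> \<open>A vector with coordinates \<open>d\<close> in the new list has coordinates \<open>f d\<close> in the old one, and \<open>h\<close>
    reverts this; here \<open>c $ i \<noteq> 0\<close> is used.\<close>
  define f where "f d = vec ?k (\<lambda>j. if j = i then d $ i * c $ i else d $ j + d $ i * c $ j)" for d
  define h where "h d = vec ?k (\<lambda>j. if j = i then d $ i / c $ i else d $ j - d $ i / c $ i * c $ j)" for d
  have basis: "polynomial_basis N V vs" using min by (simp add: minimal_basis_def)
  hence vs: "set vs \<subseteq> carrier_vec N" and bij: "bij_betw ((*\<^sub>v) ?G) ?C V"
    using polynomial_basis_iff[OF V] by auto
  have "bij_betw f ?C ?C"
    by (rule bij_betw_byWitness[where f' = h]) (use i in \<open>auto simp: f_def h_def intro!: eq_vecI\<close>)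
  hence "bij_betw ((*\<^sub>v) ?G \<circ> f) ?C V" using bij by (rule bij_betw_trans)
  moreover have "((*\<^sub>v) ?G \<circ> f) d = ?H *\<^sub>v d" if d: "d \<in> ?C" for d
  proof -
    have "?G *\<^sub>v f d = ?H *\<^sub>v d"
    proof (rule eq_vecI)
      fix r assume "r < dim_vec (?H *\<^sub>v d)"
      hence r: "r < N" by simp
      have vr: "to_fract (v $ r) = (\<Sum>j<?k. to_fract (vs ! j $ r) * c $ j)"
        using arg_cong[OF v(2), of "\<lambda>x. x $ r"] r v(1) c
        by (auto simp: scalar_prod_def atLeast0LessThan mat_of_cols_index)
      have split: "(\<Sum>j<?k. h j) = h i + (\<Sum>j\<in>{..<?k} - {i}. h j)" for h :: "nat \<Rightarrow> 'a poly fract"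
        using i by (intro sum.remove) auto
      have "(?G *\<^sub>v f d) $ r = (\<Sum>j<?k. to_fract (vs ! j $ r) * f d $ j)"
        using r by (auto simp: scalar_prod_def atLeast0LessThan mat_of_cols_index f_def intro!: sum.cong)
      also have "\<dots> = d $ i * (to_fract (vs ! i $ r) * c $ i) +
          (\<Sum>j\<in>{..<?k} - {i}. to_fract (vs ! j $ r) * d $ j + d $ i * (to_fract (vs ! j $ r) * c $ j))"
        unfolding split using i by (intro arg_cong2[where f = "(+)"] sum.cong) (auto simp: f_def algebra_simps)
      also have "\<dots> = d $ i * (\<Sum>j<?k. to_fract (vs ! j $ r) * c $ j)
          + (\<Sum>j\<in>{..<?k} - {i}. to_fract (vs ! j $ r) * d $ j)"
        unfolding split by (simp add: sum.distrib sum_distrib_left algebra_simps)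
      also have "\<dots> = to_fract (v $ r) * d $ i + (\<Sum>j\<in>{..<?k} - {i}. to_fract (vs ! j $ r) * d $ j)"
        unfolding vr by simp
      also have "\<dots> = (\<Sum>j<?k. to_fract (?ws ! j $ r) * d $ j)"
        unfolding split using i by (intro arg_cong2[where f = "(+)"] sum.cong) auto
      also have "\<dots> = (?H *\<^sub>v d) $ r"
        using r d by (auto simp: scalar_prod_def atLeast0LessThan mat_of_cols_index intro!: sum.cong)
      finally show "(?G *\<^sub>v f d) $ r = (?H *\<^sub>v d) $ r" .
    qed simp
    thus ?thesis by simp
  qed
  ultimately have "bij_betw ((*\<^sub>v) ?H) ?C V" using bij_betw_cong by blast
  moreover have "set ?ws \<subseteq> carrier_vec N" using vs v(1) set_update_subset_insert by fastforce
  ultimately have "polynomial_basis N V ?ws" by (simp add: polynomial_basis_iff[OF V])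
  hence "sum_list (map vec_degree vs) \<le> sum_list (map vec_degree ?ws)"
    using min by (simp add: minimal_basis_def)
  also have "\<dots> = sum_list (map vec_degree vs) + vec_degree v - vec_degree (vs ! i)"
    using i by (simp add: map_update sum_list_update)
  finally show ?thesis
    using i member_le_sum_list[of "vec_degree (vs ! i)" "map vec_degree vs"] by simp
qed

lemma submodule_row_space:
  fixes A :: "'a::field mat"
  assumes A: "A \<in> carrier_mat k l"
  shows "submodule class_ring (vec_space.row_space l A) (module_vec TYPE('a) l)"
proof -
  interpret vec_space "TYPE('a)" l .
  have "set (rows A) \<subseteq> carrier_vec l" using A by (auto simp: rows_def)
  thus ?thesis unfolding row_space_def using span_is_submodule by simp
qed

lemma mat_of_cols_rows: "dim_col K = l \<Longrightarrow> mat_of_cols l (rows K) = transpose_mat K"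
  by (metis cols_transpose index_transpose_mat(2) mat_of_cols_cols)

lemma minimal_basis_mat_exchange:
  fixes K :: "'a::field poly mat"
  assumes K: "K \<in> carrier_mat k l" "minimal_basis_mat K"
    and c: "c \<in> carrier_vec k"
    and v: "v \<in> carrier_vec l" "transpose_mat (rat_mat K) *\<^sub>v c = rat_vec v"
    and i: "i < k" "c $ i \<noteq> 0"
  shows "row_degree K i \<le> vec_degree v"
proof -
  have min: "minimal_basis l (vec_space.row_space l (rat_mat K)) (rows K)"
    using K by (simp add: minimal_basis_mat_def)
  have V: "submodule class_ring (vec_space.row_space l (rat_mat K)) (module_vec TYPE('a poly fract) l)"
    by (rule submodule_row_space[of _ k]) (use K in simp)
  have "rat_mat (mat_of_cols l (rows K)) = transpose_mat (rat_mat K)"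
    using K(1) by (simp add: mat_of_cols_rows map_mat_transpose)
  hence "vec_degree (rows K ! i) \<le> vec_degree v"
    using minimal_basis_exchange[OF V min, of c v i] c v i K(1) by simp
  thus ?thesis using K i by simp
qed

lemma full_row_rank_rat_mat:
  fixes K :: "'a::field poly mat"
  assumes K: "K \<in> carrier_mat k l" "minimal_basis_mat K"
  shows "full_row_rank (rat_mat K)"
proof -
  have V: "submodule class_ring (vec_space.row_space l (rat_mat K)) (module_vec TYPE('a poly fract) l)"
    by (rule submodule_row_space[of _ k]) (use K in simp)
  have "polynomial_basis l (vec_space.row_space l (rat_mat K)) (rows K)"
    using K by (simp add: minimal_basis_mat_def minimal_basis_def)
  moreover have "rat_mat (mat_of_cols l (rows K)) = transpose_mat (rat_mat K)"
    using K(1) by (simp add: mat_of_cols_rows map_mat_transpose)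
  ultimately have "inj_on ((*\<^sub>v) (transpose_mat (rat_mat K))) (carrier_vec k)"
    using polynomial_basis_iff[OF V] K(1) by (simp add: bij_betw_def)
  thus ?thesis
    using inj_on_mult_mat_vec_iff[of "transpose_mat (rat_mat K)" l k] K(1) by (simp add: full_row_rank_def)
qed

text \<open>
  A constant left kernel vector \<open>c\<close> of \<open>K\<close> at the point \<open>x\<close>, or of the coefficients of \<open>\<lambda>\<close>, produces a
  constant vector in the rational row space: \<open>c\<^sup>T K\<close> divided by \<open>\<lambda> - x\<close>, or \<open>c\<^sup>T K\<close> itself. By the
  exchange property it could replace a row of degree 1, which contradicts minimality.
\<close>

lemma linear_minimal_basis_full_row_rank:
  fixes K :: "'a::field poly mat"
  assumes K: "K \<in> carrier_mat k l" "minimal_basis_mat K"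
    and row_deg: "\<And>i. i < k \<Longrightarrow> row_degree K i = 1"
  shows "full_row_rank (eval_poly_mat K x)" and "full_row_rank (coeff_mat (\<lambda>_. 1) K)"
proof -
  have KT: "transpose_mat K \<in> carrier_mat l k" using K by simp
  have deg: "degree (K $$ (i, j)) \<le> 1" if "i < k" "j < l" for i j
    using row_deg[OF that(1)] degree_le_vec_degree[of j "row K i"] that K(1) by simp
  define cst where "cst = map_vec (\<lambda>a::'a. [:a:])"
  let ?u = "\<lambda>c. transpose_mat K *\<^sub>v cst c"
  have u: "?u c $ j = (\<Sum>i<k. smult (c $ i) (K $$ (i, j)))" if "c \<in> carrier_vec k" "j < l" for c j
    using that K(1) by (auto simp: cst_def scalar_prod_def atLeast0LessThan intro!: sum.cong)
  have deg_u: "degree (?u c $ j) \<le> 1" if "c \<in> carrier_vec k" "j < l" for c j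
    unfolding u[OF that]
  proof (rule degree_sum_le)
    fix i assume "i \<in> {..<k}"
    hence "degree (K $$ (i, j)) \<le> 1" using deg that(2) by simp
    thus "degree (smult (c $ i) (K $$ (i, j))) \<le> 1" using degree_smult_le order_trans by blast
  qed simp
  have c_0: "c = 0\<^sub>v k"
    if c: "c \<in> carrier_vec k" and v: "v \<in> carrier_vec l" "vec_degree v = 0"
      and q: "q \<noteq> 0" "?u c = q \<cdot>\<^sub>v v" for c v q
  proof (rule ccontr)
    assume "c \<noteq> 0\<^sub>v k"
    then obtain i where i: "i < k" "c $ i \<noteq> 0" using c by (auto simp: vec_eq_iff)
    let ?d = "(1 / to_fract q) \<cdot>\<^sub>v rat_vec (cst c)"
    have cc: "cst c \<in> carrier_vec k" using c by (simp add: cst_def)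
    have "transpose_mat (rat_mat K) *\<^sub>v ?d = (1 / to_fract q) \<cdot>\<^sub>v rat_vec (?u c)"
      using K(1) cc rat_mult_mat_vec[OF KT cc] by (simp add: mult_mat_vec[of _ l k] map_mat_transpose)
    also have "\<dots> = rat_vec v" unfolding q(2) rat_vec_smult smult_smult_assoc using q(1) by (intro eq_vecI) auto
    finally have "row_degree K i \<le> vec_degree v"
      using minimal_basis_mat_exchange[OF K, of ?d v i] v(1) i c q(1) by (simp add: cst_def)
    thus False using row_deg[OF i(1)] v(2) by simp
  qed
  show "full_row_rank (coeff_mat (\<lambda>_. 1) K)" unfolding full_row_rank_def
  proof (intro ballI impI)
    fix c assume "c \<in> carrier_vec (dim_row (coeff_mat (\<lambda>_. 1) K))"
      and ker: "transpose_mat (coeff_mat (\<lambda>_. 1) K) *\<^sub>v c = 0\<^sub>v (dim_col (coeff_mat (\<lambda>_. 1) K))"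
    hence c: "c \<in> carrier_vec k" using K by (simp add: coeff_mat_def)
    have "degree (?u c $ j) \<le> 0" if j: "j < l" for j
    proof -
      have "coeff (?u c $ j) 1 = (transpose_mat (coeff_mat (\<lambda>_. 1) K) *\<^sub>v c) $ j"
        unfolding u[OF c j] using j c K(1)
        by (auto simp: coeff_sum coeff_mat_def scalar_prod_def atLeast0LessThan intro!: sum.cong)
      also have "\<dots> = 0" unfolding ker using j K(1) by (simp add: coeff_mat_def)
      finally have "coeff (?u c $ j) 1 = 0" .
      thus ?thesis using deg_u[OF c j]
        by (intro degree_le) (metis One_nat_def Suc_lessI coeff_eq_0 le_less_trans)
    qed
    hence "vec_degree (?u c) \<le> 0" using K(1) unfolding vec_degree_le_iff by simp
    moreover have "?u c \<in> carrier_vec l" using K(1) by (intro carrier_vecI) simp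
    moreover have "?u c = 1 \<cdot>\<^sub>v ?u c" by (intro eq_vecI) auto
    ultimately have "c = 0\<^sub>v k" by (intro c_0[OF c, of "?u c" 1]) auto
    thus "c = 0\<^sub>v (dim_row (coeff_mat (\<lambda>_. 1) K))" using K by (simp add: coeff_mat_def)
  qed
  show "full_row_rank (eval_poly_mat K x)" unfolding full_row_rank_def
  proof (intro ballI impI)
    fix c assume "c \<in> carrier_vec (dim_row (eval_poly_mat K x))"
      and ker: "transpose_mat (eval_poly_mat K x) *\<^sub>v c = 0\<^sub>v (dim_col (eval_poly_mat K x))"
    hence c: "c \<in> carrier_vec k" using K by (simp add: eval_poly_mat_def)
    have "[:-x, 1:] dvd ?u c $ j" if j: "j < l" for j
    proof -
      have "poly (?u c $ j) x = (transpose_mat (eval_poly_mat K x) *\<^sub>v c) $ j"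
        unfolding u[OF c j] using j c K(1)
        by (auto simp: poly_sum eval_poly_mat_def scalar_prod_def atLeast0LessThan intro!: sum.cong)
      also have "\<dots> = 0" unfolding ker using j K(1) by (simp add: eval_poly_mat_def)
      finally show ?thesis by (simp add: poly_eq_0_iff_dvd)
    qed
    then obtain w where w: "\<And>j. j < l \<Longrightarrow> ?u c $ j = [:-x, 1:] * w j" unfolding dvd_def by metis
    have "degree (w j) \<le> 0" if j: "j < l" for j
    proof (cases "w j = 0")
      case False
      hence "degree (?u c $ j) = 1 + degree (w j)"
        unfolding w[OF j] by (subst degree_mult_eq) auto
      thus ?thesis using deg_u[OF c j] by simp
    qed simp
    hence "vec_degree (vec l w) \<le> 0" unfolding vec_degree_le_iff by simp
    moreover have "?u c = [:-x, 1:] \<cdot>\<^sub>v vec l w"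
      by (rule eq_vecI) (use w K(1) in auto)
    ultimately have "c = 0\<^sub>v k" by (intro c_0[OF c, of "vec l w" "[:-x, 1:]"]) auto
    thus "c = 0\<^sub>v (dim_row (eval_poly_mat K x))" using K by (simp add: eval_poly_mat_def)
  qed
qed

text \<open>
  A zero row in the echelon form would be a nontrivial combination of the rows of \<open>G\<close>, so every row
  carries a pivot.
\<close>

lemma kernel_dim_full_row_rank:
  fixes G :: "'a::field mat"
  assumes G: "G \<in> carrier_mat q l" and rank: "full_row_rank G"
  shows "kernel.dim l G = l - q"
proof -
  obtain E where E: "gauss_jordan_single G = E" by simp
  note gj = gauss_jordan_single[OF G E]
  from gj(4) obtain P Q where P: "P \<in> carrier_mat q q" and Q: "Q \<in> carrier_mat q q"
    and EP: "E = P * G" and inv: "P * Q = 1\<^sub>m q" "Q * P = 1\<^sub>m q" by blast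
  have "row E i \<noteq> 0\<^sub>v l" if i: "i < q" for i
  proof
    assume 0: "row E i = 0\<^sub>v l"
    have "transpose_mat G *\<^sub>v row P i = 0\<^sub>v l"
    proof (rule eq_vecI)
      fix j assume "j < dim_vec (0\<^sub>v l :: 'a vec)"
      hence j: "j < l" by simp
      have "row E i $ j = row P i \<bullet> col G j" unfolding EP using i j P G by simp
      also have "\<dots> = (transpose_mat G *\<^sub>v row P i) $ j"
        using i j P G by (simp add: comm_scalar_prod[of _ q])
      finally show "(transpose_mat G *\<^sub>v row P i) $ j = 0\<^sub>v l $ j" using 0 j by simp
    qed (use G in simp)
    hence "row P i = 0\<^sub>v q" using rank i P G unfolding full_row_rank_def by simp
    hence "(P * Q) $$ (i, i) = 0" using i P Q by simp
    thus False using i unfolding inv by simp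
  qed
  hence rows: "{i. i < q \<and> row E i \<noteq> 0\<^sub>v l} = {..<q}" by auto
  have ker: "mat_kernel E = mat_kernel G" unfolding EP by (rule mat_kernel_mult_eq[OF G P Q inv(2)])
  interpret kernel q l G by (rule kernel.intro[OF G])
  note base = find_base_vectors[OF gj(3,2)]
  have "basis (set (find_base_vectors E))" using base(3) unfolding ker .
  from Ker.dim_basis[OF _ this] show ?thesis using base(4) by (simp add: rows)
qed

text \<open>
  The rows of \<open>K\<close> are \<open>k = l - q\<close> independent vectors of the kernel of \<open>G\<close>, which has this dimension, so
  they span it.
\<close>

lemma kernel_eq_row_space_of_dual:
  fixes K G :: "'a::field mat"
  assumes K: "K \<in> carrier_mat k l" "full_row_rank K"
    and G: "G \<in> carrier_mat q l" "full_row_rank G"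
    and dual: "k + q = l" "K * transpose_mat G = 0\<^sub>m k q"
    and v: "v \<in> carrier_vec l" "G *\<^sub>v v = 0\<^sub>v q"
  shows "\<exists>y \<in> carrier_vec k. transpose_mat K *\<^sub>v y = v"
proof -
  interpret kernel q l G by (rule kernel.intro[OF G(1)])
  have rows: "set (rows K) \<subseteq> carrier_vec l" using K(1) by (auto simp: rows_def)
  have cols: "mat_of_cols l (rows K) = transpose_mat K" using K(1) by (simp add: mat_of_cols_rows)
  have inj: "inj_on ((*\<^sub>v) (transpose_mat K)) (carrier_vec k)"
    using inj_on_mult_mat_vec_iff[of "transpose_mat K" l k] K by (simp add: full_row_rank_def)
  hence indpt: "distinct (rows K)" "NC.lin_indpt (set (rows K))"
    using NC.lin_indpt_list_iff_inj_on[OF rows] K(1) by (simp_all add: cols)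
  have "G *\<^sub>v row K i = 0\<^sub>v q" if i: "i < k" for i
  proof (rule eq_vecI)
    fix j assume "j < dim_vec (0\<^sub>v q :: 'a vec)"
    hence j: "j < q" by simp
    have "(K * transpose_mat G) $$ (i, j) = (G *\<^sub>v row K i) $ j"
      using i j K(1) G(1) by (simp add: comm_scalar_prod[of _ l])
    thus "(G *\<^sub>v row K i) $ j = 0\<^sub>v q $ j" using i j by (simp add: dual)
  qed (use G in simp)
  hence ker: "set (rows K) \<subseteq> mat_kernel G"
    using K(1) by (auto simp: rows_def intro!: mat_kernelI[OF G(1)])
  have dim: "dim = k" using kernel_dim_full_row_rank[OF G] dual(1) by simp
  have "card (set (rows K)) = k" using indpt(1) K(1) by (simp add: distinct_card)
  moreover obtain B where "finite B" "basis B" using kernel_basis_exists[OF G(1)] by blast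
  hence "Ker.fin_dim" unfolding Ker.fin_dim_def Ker.basis_def by blast
  ultimately have "basis (set (rows K))"
    using Ker.dim_li_is_basis[of "set (rows K)"] lindep_same[OF ker] indpt(2) ker dim by simp
  hence "span (set (rows K)) = mat_kernel G" by (simp add: Ker.basis_def)
  hence "mat_kernel G = (*\<^sub>v) (transpose_mat K) ` carrier_vec k"
    using span_same[OF ker] NC.span_list_eq_image[OF rows] K(1) by (simp add: cols)
  moreover have "v \<in> mat_kernel G" by (rule mat_kernelI[OF G(1) v])
  ultimately show ?thesis by auto
qed

text \<open>
  Duality gives a rational solution \<open>y\<close>; full row rank of \<open>K\<close> at every point and at infinity makes it
  polynomial and saves one degree.
\<close>

theorem dual_minimal_bases_lift:
  fixes K :: "'a::alg_closed_field poly mat"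
  assumes K: "K \<in> carrier_mat k l" and row_deg: "\<And>i. i < k \<Longrightarrow> row_degree K i = 1"
    and dual: "dual_minimal_bases K G"
    and v: "v \<in> carrier_vec l" "G *\<^sub>v v = 0\<^sub>v (dim_row G)" "vec_degree v \<le> d + 1"
  shows "\<exists>y \<in> carrier_vec k. transpose_mat K *\<^sub>v y = v \<and> vec_degree y \<le> d"
proof -
  let ?q = "dim_row G"
  have G: "G \<in> carrier_mat ?q l" and kq: "k + ?q = l" and KG: "K * transpose_mat G = 0\<^sub>m k ?q"
    and min: "minimal_basis_mat K" "minimal_basis_mat G"
    using dual unfolding dual_minimal_bases_def carrier_matD[OF K] by (blast intro: carrier_matI)+
  have KT: "transpose_mat K \<in> carrier_mat l k" using K by simp
  have "rat_mat K * transpose_mat (rat_mat G) = rat_mat (K * transpose_mat G)"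
    unfolding map_mat_transpose by (rule rat_mat_mult[OF K, symmetric]) (use G in \<open>simp only: transpose_carrier_mat\<close>)
  also have "\<dots> = 0\<^sub>m k ?q" unfolding KG by (intro eq_matI) auto
  finally have KG': "rat_mat K * transpose_mat (rat_mat G) = 0\<^sub>m k ?q" .
  have "rat_mat G *\<^sub>v rat_vec v = rat_vec (0\<^sub>v ?q)"
    unfolding v(2)[symmetric] by (rule rat_mult_mat_vec[OF G v(1), symmetric])
  also have "\<dots> = 0\<^sub>v ?q" by (intro eq_vecI) auto
  finally have "\<exists>y \<in> carrier_vec k. transpose_mat (rat_mat K) *\<^sub>v y = rat_vec v"
    by (rule kernel_eq_row_space_of_dual[OF _ full_row_rank_rat_mat[OF K min(1)] _
      full_row_rank_rat_mat[OF G min(2)] kq KG', rotated -1])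
      (use K G v(1) in \<open>simp_all only: map_carrier_mat map_carrier_vec\<close>)
  then obtain y where y: "y \<in> carrier_vec k" "transpose_mat (rat_mat K) *\<^sub>v y = rat_vec v" by blast
  note rank = linear_minimal_basis_full_row_rank[OF K min(1) row_deg]
  obtain y' where y': "y' \<in> carrier_vec k" "y = rat_vec y'"
    using polynomial_of_full_row_rank[OF K rank(1) y] by blast
  have "rat_vec (transpose_mat K *\<^sub>v y') = rat_vec v"
    using y(2) y' rat_mult_mat_vec[OF KT y'(1)] by (simp add: map_mat_transpose)
  hence Ky: "transpose_mat K *\<^sub>v y' = v" by simp
  have "vec_degree y' \<le> d"
  proof (rule vec_degree_of_full_row_rank[OF K _ rank(2) y'(1)])
    show "degree (K $$ (i, j)) \<le> 1" if "i < k" "j < l" for i j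
      using row_deg[OF that(1)] degree_le_vec_degree[of j "row K i"] that K by simp
    show "degree ((transpose_mat K *\<^sub>v y') $ j) \<le> d + 1" if "j < l" for j
      unfolding Ky using degree_le_vec_degree[of j v] v(1,3) that by simp
  qed
  thus ?thesis using y'(1) Ky by blast
qed

section \<open>Left nullspaces of system matrices and transfer functions\<close>

lemma full_row_rank_of_rank:
  fixes G :: "'a::field mat"
  assumes G: "G \<in> carrier_mat n l" and rank: "vec_space.rank n G = n"
  shows "full_row_rank G"
proof -
  interpret vec_space "TYPE('a)" n .
  have cols: "set (cols G) \<subseteq> carrier_vec n" using G by (auto simp: cols_def)
  obtain S where S: "maximal S (\<lambda>T. T \<subseteq> set (cols G) \<and> lin_indpt T)"
    using maximal_exists[of "(\<lambda>T. T \<subseteq> set (cols G) \<and> lin_indpt T)" "card (set (cols G))" "{}"]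
    by (meson List.finite_set card_mono empty_iff empty_subsetI finite_lin_indpt2 rev_finite_subset)
  hence sub: "S \<subseteq> set (cols G)" and indpt: "lin_indpt S" by (auto simp: maximal_def)
  have "card S = n" using rank_card_indpt[OF G S] rank by simp
  hence "basis S"
    using dim_li_is_basis[of S] sub cols indpt dim_is_n finite_subset[OF sub] by simp
  hence "carrier_vec n \<subseteq> span (set (cols G))"
    using span_is_monotone[OF sub] by (simp add: basis_def)
  moreover have "mat_of_cols n (cols G) = G" using G by (metis carrier_matD(1) mat_of_cols_cols)
  ultimately have image: "carrier_vec n \<subseteq> (*\<^sub>v) G ` carrier_vec l"
    using span_list_eq_image[OF cols] G by simp
  have "c = 0\<^sub>v n" if c: "c \<in> carrier_vec n" "transpose_mat G *\<^sub>v c = 0\<^sub>v l" for c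
  proof (rule eq_vecI)
    fix i assume "i < dim_vec (0\<^sub>v n :: 'a vec)"
    hence i: "i < n" by simp
    obtain d where d: "d \<in> carrier_vec l" "unit_vec n i = G *\<^sub>v d"
      using image unit_vec_carrier[of n i] by blast
    have "c $ i = c \<bullet> unit_vec n i" using c i by simp
    also have "\<dots> = (transpose_mat G *\<^sub>v c) \<bullet> d"
      unfolding d(2) using transpose_vec_mult_scalar[OF G d(1) c(1)] by simp
    also have "\<dots> = 0" unfolding c(2) using d(1) by simp
    finally show "c $ i = 0\<^sub>v n $ i" using i by simp
  qed (use c in simp)
  thus ?thesis using G by (simp add: full_row_rank_def)
qed

lemma append_cols_carrier [simp]:
  "A \<in> carrier_mat n k \<Longrightarrow> B \<in> carrier_mat n m \<Longrightarrow> append_cols A B \<in> carrier_mat n (k + m)"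
  unfolding append_cols_def carrier_mat_def by auto

lemma append_cols_index:
  assumes "A \<in> carrier_mat n k" "B \<in> carrier_mat n m" "i < n" "j < k + m"
  shows "append_cols A B $$ (i, j) = (if j < k then A $$ (i, j) else B $$ (i, j - k))"
  using assms by (auto simp: append_cols_def)

lemma transpose_append_cols_mult_vec:
  fixes A B :: "'a::comm_ring_1 mat"
  assumes A: "A \<in> carrier_mat n k" and B: "B \<in> carrier_mat n m" and y: "y \<in> carrier_vec n"
  shows "transpose_mat (append_cols A B) *\<^sub>v y = (transpose_mat A *\<^sub>v y) @\<^sub>v (transpose_mat B *\<^sub>v y)"
proof (rule eq_vecI)
  fix j assume "j < dim_vec ((transpose_mat A *\<^sub>v y) @\<^sub>v (transpose_mat B *\<^sub>v y))"
  hence j: "j < k + m" using A B by simp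
  have "row (transpose_mat (append_cols A B)) j
      = (if j < k then row (transpose_mat A) j else row (transpose_mat B) (j - k))"
    using j A B by (intro eq_vecI) (auto simp: append_cols_def)
  thus "(transpose_mat (append_cols A B) *\<^sub>v y) $ j
      = ((transpose_mat A *\<^sub>v y) @\<^sub>v (transpose_mat B *\<^sub>v y)) $ j"
    using j A B carrier_matD[OF append_cols_carrier[OF A B]] by simp
qed (use A B carrier_matD[OF append_cols_carrier[OF A B]] in simp)

lemma transpose_append_rows_mult_vec:
  fixes M K :: "'a::comm_ring_1 mat"
  assumes M: "M \<in> carrier_mat n l" and K: "K \<in> carrier_mat k l"
    and a: "a \<in> carrier_vec n" and b: "b \<in> carrier_vec k"
  shows "transpose_mat (M @\<^sub>r K) *\<^sub>v (a @\<^sub>v b) = transpose_mat M *\<^sub>v a + transpose_mat K *\<^sub>v b"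
proof (rule eq_vecI)
  have MK: "M @\<^sub>r K \<in> carrier_mat (n + k) l" using M K by simp
  fix j assume "j < dim_vec (transpose_mat M *\<^sub>v a + transpose_mat K *\<^sub>v b)"
  hence j: "j < l" using K by simp
  have "row (transpose_mat (M @\<^sub>r K)) j = row (transpose_mat M) j @\<^sub>v row (transpose_mat K) j"
    using j M K MK by (intro eq_vecI) (auto simp: append_rows_def)
  thus "(transpose_mat (M @\<^sub>r K) *\<^sub>v (a @\<^sub>v b)) $ j = (transpose_mat M *\<^sub>v a + transpose_mat K *\<^sub>v b) $ j"
    using j M K carrier_matD[OF MK] a b by (simp add: scalar_prod_append[of _ n _ k])
qed (use M K in \<open>simp add: append_rows_def\<close>)

lemma rat_mat_append_rows:
  assumes "M \<in> carrier_mat n l" "K \<in> carrier_mat k l"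
  shows "rat_mat (M @\<^sub>r K) = rat_mat M @\<^sub>r rat_mat K"
  using assms by (intro eq_matI) (auto simp: append_rows_def)

lemma left_nullspace_iff:
  assumes "G \<in> carrier_mat n l"
  shows "u \<in> left_nullspace G \<longleftrightarrow> u \<in> carrier_vec n \<and> transpose_mat G *\<^sub>v u = 0\<^sub>v l"
  using assms mat_kernel[of "transpose_mat G" l n] by (simp add: left_nullspace_def)

lemma left_nullspace_polynomial_system_matrix:
  assumes A: "A \<in> carrier_mat n k" and B: "B \<in> carrier_mat n m"
    and C: "C \<in> carrier_mat p k" and D: "D \<in> carrier_mat p m"
    and y: "y \<in> carrier_vec n" and u: "u \<in> carrier_vec p"
  shows "y @\<^sub>v u \<in> left_nullspace (rat_mat (polynomial_system_matrix A B C D)) \<longleftrightarrow>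
    transpose_mat (rat_mat A) *\<^sub>v y = transpose_mat (rat_mat C) *\<^sub>v u \<and>
    transpose_mat (rat_mat B) *\<^sub>v y + transpose_mat (rat_mat D) *\<^sub>v u = 0\<^sub>v m"
proof -
  let ?L = "rat_mat (polynomial_system_matrix A B C D)"
  have L: "?L \<in> carrier_mat (n + p) (k + m)"
    using A B C D by (simp add: polynomial_system_matrix_def)
  have "rat_mat (- C) = - rat_mat C" by (intro eq_matI) auto
  hence "?L = four_block_mat (rat_mat A) (rat_mat B) (- rat_mat C) (rat_mat D)"
    unfolding polynomial_system_matrix_def
    using A B C D by (simp add: map_four_block_mat[of _ n k _ m _ p])
  hence "transpose_mat ?L = four_block_mat (transpose_mat (rat_mat A)) (transpose_mat (- rat_mat C))
      (transpose_mat (rat_mat B)) (transpose_mat (rat_mat D))"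
    using A B C D by (simp add: transpose_four_block_mat[of _ n k _ m _ p])
  hence "transpose_mat ?L *\<^sub>v (y @\<^sub>v u)
      = (transpose_mat (rat_mat A) *\<^sub>v y + transpose_mat (- rat_mat C) *\<^sub>v u)
        @\<^sub>v (transpose_mat (rat_mat B) *\<^sub>v y + transpose_mat (rat_mat D) *\<^sub>v u)"
    using A B C D y u by (simp add: four_block_mat_mult_vec[of _ k n _ p _ m])
  also have "transpose_mat (- rat_mat C) *\<^sub>v u = - (transpose_mat (rat_mat C) *\<^sub>v u)"
    using C u by (intro eq_vecI) (auto simp: scalar_prod_def sum_negf)
  finally have mult: "transpose_mat ?L *\<^sub>v (y @\<^sub>v u)
      = (transpose_mat (rat_mat A) *\<^sub>v y + - (transpose_mat (rat_mat C) *\<^sub>v u))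
        @\<^sub>v (transpose_mat (rat_mat B) *\<^sub>v y + transpose_mat (rat_mat D) *\<^sub>v u)" .
  have zero: "(0\<^sub>v (k + m) :: 'a poly fract vec) = 0\<^sub>v k @\<^sub>v 0\<^sub>v m" by (intro eq_vecI) auto
  have sub: "v + - w = 0\<^sub>v k \<longleftrightarrow> v = w"
    if "v \<in> carrier_vec k" "w \<in> carrier_vec k" for v w :: "'a poly fract vec"
    using that by (auto simp: vec_eq_iff)
  have Ay: "transpose_mat (rat_mat A) *\<^sub>v y \<in> carrier_vec k"
    and Cu: "transpose_mat (rat_mat C) *\<^sub>v u \<in> carrier_vec k"
    using A C by (auto intro!: carrier_vecI)
  hence "transpose_mat (rat_mat A) *\<^sub>v y + - (transpose_mat (rat_mat C) *\<^sub>v u) \<in> carrier_vec k" by simp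
  thus ?thesis
    unfolding left_nullspace_iff[OF L] mult zero using y u sub[OF Ay Cu] by simp
qed

text \<open>
  The state part \<open>y\<close> can only be \<open>(u\<^sup>T C A\<^sup>-\<^sup>1)\<^sup>T\<close>, and substituting it into the second equation gives
  \<open>u\<^sup>T (D + C A\<^sup>-\<^sup>1 B) = 0\<close>.
\<close>

lemma left_nullspace_transfer_function:
  fixes A :: "'a::field poly mat"
  assumes A: "A \<in> carrier_mat n n" "regular_mat A" and B: "B \<in> carrier_mat n m"
    and C: "C \<in> carrier_mat p n" and D: "D \<in> carrier_mat p m"
  shows "transfer_function A B C D \<in> carrier_mat p m"
    and "u \<in> carrier_vec p \<Longrightarrow> u \<in> left_nullspace (transfer_function A B C D) \<longleftrightarrow>
      (\<exists>y \<in> carrier_vec n. transpose_mat (rat_mat A) *\<^sub>v y = transpose_mat (rat_mat C) *\<^sub>v u \<and>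
        transpose_mat (rat_mat B) *\<^sub>v y + transpose_mat (rat_mat D) *\<^sub>v u = 0\<^sub>v m)"
proof -
  interpret hom: comm_ring_hom "to_fract :: 'a poly \<Rightarrow> _" by unfold_locales auto
  have "det (rat_mat A) \<noteq> 0" using A(2) by (simp add: regular_mat_def)
  hence "rat_mat A \<in> Units (ring_mat TYPE('a poly fract) n ())"
    using A(1) det_non_zero_imp_unit by (metis map_carrier_mat)
  then obtain X where "mat_inverse (rat_mat A) = Some X"
    using mat_inverse(1)[of "rat_mat A" n "()"] A(1) by fastforce
  note X0 = this mat_inverse(2)[OF _ this, of n]
  let ?A = "rat_mat A" and ?B = "rat_mat B" and ?C = "rat_mat C" and ?D = "rat_mat D"
  have c: "?A \<in> carrier_mat n n" "?B \<in> carrier_mat n m" "?C \<in> carrier_mat p n" "?D \<in> carrier_mat p m"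
    using A B C D by auto
  have X: "X \<in> carrier_mat n n" "?A * X = 1\<^sub>m n" "X * ?A = 1\<^sub>m n" using X0(2) c by auto
  have R: "transfer_function A B C D = ?D + ?C * X * ?B" by (simp add: transfer_function_def X0(1))
  show carr: "transfer_function A B C D \<in> carrier_mat p m" unfolding R using c X(1) by simp
  have XT: "transpose_mat ?A * transpose_mat X = 1\<^sub>m n" "transpose_mat X * transpose_mat ?A = 1\<^sub>m n"
    unfolding transpose_mult[OF X(1) c(1), symmetric] transpose_mult[OF c(1) X(1), symmetric] X(2,3)
    by simp_all
  assume u: "u \<in> carrier_vec p"
  define y0 where "y0 = transpose_mat X *\<^sub>v (transpose_mat ?C *\<^sub>v u)"
  have Cu: "transpose_mat ?C *\<^sub>v u \<in> carrier_vec n" using c(3) u by (intro mult_mat_vec_carrier[of _ n p]) auto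
  have y0: "y0 \<in> carrier_vec n" unfolding y0_def using X(1) by (intro carrier_vecI) simp
  have y_iff: "transpose_mat ?A *\<^sub>v y = transpose_mat ?C *\<^sub>v u \<longleftrightarrow> y = y0" if y: "y \<in> carrier_vec n" for y
  proof
    assume "transpose_mat ?A *\<^sub>v y = transpose_mat ?C *\<^sub>v u"
    hence "y0 = (transpose_mat X * transpose_mat ?A) *\<^sub>v y"
      unfolding y0_def using X(1) c(1) y by (simp add: assoc_mult_mat_vec[of _ n n _ n])
    thus "y = y0" unfolding XT using y by simp
  next
    assume "y = y0"
    hence "transpose_mat ?A *\<^sub>v y = (transpose_mat ?A * transpose_mat X) *\<^sub>v (transpose_mat ?C *\<^sub>v u)"
      unfolding y0_def using X(1) c(1) Cu by (simp add: assoc_mult_mat_vec[of _ n n _ n])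
    thus "transpose_mat ?A *\<^sub>v y = transpose_mat ?C *\<^sub>v u" unfolding XT using Cu by simp
  qed
  have "transpose_mat (?D + ?C * X * ?B)
      = transpose_mat ?D + transpose_mat ?B * (transpose_mat X * transpose_mat ?C)"
    using c X(1) by (simp add: transpose_add[of _ p m] transpose_mult[of _ p n _ m] transpose_mult[of _ n n _ m])
  also have "\<dots> *\<^sub>v u = transpose_mat ?D *\<^sub>v u + transpose_mat ?B *\<^sub>v y0"
    using c X(1) u Cu unfolding y0_def
    by (simp add: add_mult_distrib_mat_vec[of _ m p] assoc_mult_mat_vec[of _ m n _ p] assoc_mult_mat_vec[of _ n n _ p])
  also have "\<dots> = transpose_mat ?B *\<^sub>v y0 + transpose_mat ?D *\<^sub>v u"
    using c by (intro comm_add_vec[of _ m]) (auto intro!: carrier_vecI)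
  finally have "transpose_mat (transfer_function A B C D) *\<^sub>v u
      = transpose_mat ?B *\<^sub>v y0 + transpose_mat ?D *\<^sub>v u" unfolding R .
  thus "u \<in> left_nullspace (transfer_function A B C D) \<longleftrightarrow>
      (\<exists>y \<in> carrier_vec n. transpose_mat ?A *\<^sub>v y = transpose_mat ?C *\<^sub>v u \<and>
        transpose_mat ?B *\<^sub>v y + transpose_mat ?D *\<^sub>v u = 0\<^sub>v m)"
    using u y0 y_iff left_nullspace_iff[OF carr] by auto
qed

lemma vec_degree_mult_mat_vec_le:
  fixes G :: "'a::comm_ring_1 poly mat"
  assumes G: "G \<in> carrier_mat nr nc" and v: "v \<in> carrier_vec nc" "vec_degree v \<le> d"
    and deg: "\<And>i j. i < nr \<Longrightarrow> j < nc \<Longrightarrow> degree (G $$ (i, j)) \<le> g"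
  shows "vec_degree (G *\<^sub>v v) \<le> d + g"
  unfolding vec_degree_le_iff
proof (intro allI impI)
  fix i assume "i < dim_vec (G *\<^sub>v v)"
  hence i: "i < nr" using G by simp
  have "(G *\<^sub>v v) $ i = (\<Sum>j<nc. G $$ (i, j) * v $ j)"
    using i G v by (auto simp: scalar_prod_def atLeast0LessThan intro!: sum.cong)
  moreover have "degree (G $$ (i, j) * v $ j) \<le> d + g" if j: "j < nc" for j
  proof -
    have "degree (v $ j) \<le> d" using degree_le_vec_degree[of j v] v j by simp
    thus ?thesis using degree_mult_le[of "G $$ (i, j)" "v $ j"] deg[OF i j] by linarith
  qed
  ultimately show "degree ((G *\<^sub>v v) $ i) \<le> d + g" by (auto intro!: degree_sum_le)
qed

lemma vec_degree_add_le:
  assumes "dim_vec v = dim_vec w" "vec_degree v \<le> d" "vec_degree w \<le> d"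
  shows "vec_degree (v + w) \<le> d"
  using assms by (auto simp: vec_degree_le_iff intro: degree_add_le)

lemma vec_degree_uminus [simp]: "vec_degree (- v) = vec_degree (v :: 'a::ab_group_add poly vec)"
proof -
  have "{degree ((- v) $ i) | i. i < dim_vec (- v)} = {degree (v $ i) | i. i < dim_vec v}" by force
  thus ?thesis by (simp add: vec_degree_def)
qed

lemma vec_degree_append_le:
  assumes "vec_degree v \<le> d" "vec_degree w \<le> d"
  shows "vec_degree (v @\<^sub>v w) \<le> d"
  using assms by (auto simp: vec_degree_le_iff)

lemma degree_le_mat_degree:
  assumes "P \<in> carrier_mat nr nc" "i < nr" "j < nc"
  shows "degree (P $$ (i, j)) \<le> mat_degree P"
proof -
  have "{degree (P $$ (i, j)) | i j. i < dim_row P \<and> j < dim_col P}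
      = (\<lambda>(i, j). degree (P $$ (i, j))) ` ({..<dim_row P} \<times> {..<dim_col P})" by auto
  thus ?thesis unfolding mat_degree_def using assms by (intro Max_ge) auto
qed

lemma degree_linear_mult_transpose_le:
  fixes M :: "'a::comm_ring_1 poly mat"
  assumes M: "M \<in> carrier_mat k l" and lin: "\<And>i j. i < k \<Longrightarrow> j < l \<Longrightarrow> degree (M $$ (i, j)) \<le> 1"
    and G: "G \<in> carrier_mat q l" and ij: "i < k" "j < q"
  shows "degree ((M * transpose_mat G) $$ (i, j)) \<le> mat_degree G + 1"
proof -
  have "(M * transpose_mat G) $$ (i, j) = (\<Sum>h<l. M $$ (i, h) * G $$ (j, h))"
    using M G ij by (auto simp: scalar_prod_def atLeast0LessThan intro!: sum.cong)
  moreover have "degree (M $$ (i, h) * G $$ (j, h)) \<le> mat_degree G + 1" if h: "h < l" for h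
    using degree_mult_le[of "M $$ (i, h)" "G $$ (j, h)"] lin[OF ij(1) h] degree_le_mat_degree[OF G ij(2) h]
    by linarith
  ultimately show ?thesis by (auto intro!: degree_sum_le)
qed

section \<open>The linearized system matrix\<close>

lemma mult_transpose_mult_vec:
  fixes M G :: "'a::comm_ring_1 mat"
  assumes M: "M \<in> carrier_mat n l" and G: "G \<in> carrier_mat q l" and y: "y \<in> carrier_vec n"
  shows "G *\<^sub>v (transpose_mat M *\<^sub>v y) = transpose_mat (M * transpose_mat G) *\<^sub>v y"
proof -
  have "transpose_mat (M * transpose_mat G) = G * transpose_mat M"
    using transpose_mult[OF M, of "transpose_mat G" q] G by simp
  thus ?thesis using assoc_mult_mat_vec[OF G _ y, of "transpose_mat M"] M by simp
qed

lemma vec_slice_append: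
  assumes "a \<in> carrier_vec k" "b \<in> carrier_vec M"
  shows "vec_slice k M (a @\<^sub>v b) = b" "vec_slice k M (a @\<^sub>v (b @\<^sub>v c)) = b"
  using assms by (auto intro!: eq_vecI)

lemma mult_mat_vec_uminus:
  fixes G :: "'a::comm_ring_1 mat"
  assumes "G \<in> carrier_mat q l" "v \<in> carrier_vec l"
  shows "G *\<^sub>v (- v) = - (G *\<^sub>v v)"
  using assms by (intro eq_vecI) (auto simp: scalar_prod_def sum_negf)

lemma rat_vec_append: "rat_vec (v @\<^sub>v w) = rat_vec v @\<^sub>v rat_vec w"
  by (intro eq_vecI) auto

lemma rat_mult_transpose_mult_vec:
  fixes M :: "'a::field poly mat"
  assumes "M \<in> carrier_mat r l" "G \<in> carrier_mat q l" "v \<in> carrier_vec r"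
  shows "rat_mat G *\<^sub>v (transpose_mat (rat_mat M) *\<^sub>v v) = transpose_mat (rat_mat (M * transpose_mat G)) *\<^sub>v v"
proof -
  have "rat_mat (M * transpose_mat G) = rat_mat M * transpose_mat (rat_mat G)"
    unfolding map_mat_transpose by (rule rat_mat_mult) (use assms in auto)
  thus ?thesis using mult_transpose_mult_vec[of "rat_mat M" r l "rat_mat G" q v] assms by simp
qed

lemma rat_mult_dual_eq_zero:
  fixes K :: "'a::field poly mat"
  assumes "K \<in> carrier_mat k l" "G \<in> carrier_mat q l" "v \<in> carrier_vec k"
    and "K * transpose_mat G = 0\<^sub>m k q"
  shows "rat_mat G *\<^sub>v (transpose_mat (rat_mat K) *\<^sub>v v) = 0\<^sub>v q"
  unfolding rat_mult_transpose_mult_vec[OF assms(1-3)] assms(4) using assms(3) by (intro eq_vecI) (auto simp: scalar_prod_def)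

lemma transpose_rat_mult_carrier:
  "M \<in> carrier_mat r l \<Longrightarrow> transpose_mat (rat_mat M) *\<^sub>v v \<in> carrier_vec l"
  by (intro carrier_vecI) simp

text \<open>
  The two rank conditions appear as full row rank of \<open>[A B]\<close> at each point and of its coefficients at
  the largest degrees that \<open>M_A N_A\<^sup>T\<close> and \<open>M_B N_D\<^sup>T\<close> can have.
\<close>

locale strong_block_minimal_system =
  fixes A B C D M_A K_A N_A M_D K_D N_D M_B M_C :: "'a::alg_closed_field poly mat"
    and n m p kA lA kD lD :: nat
  assumes A: "A \<in> carrier_mat n n" "regular_mat A"
    and M_A: "M_A \<in> carrier_mat n lA" "linear_poly_mat M_A" "M_A * transpose_mat N_A = A"
    and M_B: "M_B \<in> carrier_mat n lD" "linear_poly_mat M_B" "M_B * transpose_mat N_D = B"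
    and M_C: "M_C \<in> carrier_mat p lA" "linear_poly_mat M_C" "M_C * transpose_mat N_A = C"
    and M_D: "M_D \<in> carrier_mat p lD" "linear_poly_mat M_D" "M_D * transpose_mat N_D = D"
    and N_A: "N_A \<in> carrier_mat n lA" and N_D: "N_D \<in> carrier_mat m lD"
    and K_A: "K_A \<in> carrier_mat kA lA" "\<And>i. i < kA \<Longrightarrow> row_degree K_A i = 1" "dual_minimal_bases K_A N_A"
    and K_D: "K_D \<in> carrier_mat kD lD" "\<And>i. i < kD \<Longrightarrow> row_degree K_D i = 1" "dual_minimal_bases K_D N_D"
    and rank_finite: "full_row_rank (append_cols (eval_poly_mat A x) (eval_poly_mat B x))"
    and rank_infinite: "full_row_rank (append_cols (coeff_mat (\<lambda>_. mat_degree N_A + 1) A)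
      (coeff_mat (\<lambda>_. mat_degree N_D + 1) B))"
begin

abbreviation "L_A \<equiv> M_A @\<^sub>r K_A"
abbreviation "L_B \<equiv> M_B @\<^sub>r 0\<^sub>m kA lD"
abbreviation "L_C \<equiv> M_C @\<^sub>r 0\<^sub>m kD lA"
abbreviation "L_D \<equiv> M_D @\<^sub>r K_D"
abbreviation "L \<equiv> polynomial_system_matrix L_A L_B L_C L_D"
abbreviation "R \<equiv> transfer_function A B C D"
abbreviation "R_hat \<equiv> transfer_function L_A L_B L_C L_D"

lemma B: "B \<in> carrier_mat n m" and C: "C \<in> carrier_mat p n" and D: "D \<in> carrier_mat p m"
  using M_B M_C M_D N_A N_D by auto

lemma lA: "kA + n = lA" and lD: "kD + m = lD"
  and KN_A: "K_A * transpose_mat N_A = 0\<^sub>m kA n" and KN_D: "K_D * transpose_mat N_D = 0\<^sub>m kD m"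
  and min_A: "minimal_basis_mat K_A" and min_D: "minimal_basis_mat K_D"
  using K_A K_D N_A N_D by (simp_all add: dual_minimal_bases_def)

lemma L_carriers: "L_A \<in> carrier_mat (n + kA) lA" "L_B \<in> carrier_mat (n + kA) lD"
    "L_C \<in> carrier_mat (p + kD) lA" "L_D \<in> carrier_mat (p + kD) lD"
  using M_A M_B M_C M_D K_A K_D by auto

lemma left_nullspace_L_iff:
  assumes y1: "y1 \<in> carrier_vec n" and y2: "y2 \<in> carrier_vec kA"
    and u: "u \<in> carrier_vec p" and w: "w \<in> carrier_vec kD"
  shows "(y1 @\<^sub>v y2) @\<^sub>v (u @\<^sub>v w) \<in> left_nullspace (rat_mat L) \<longleftrightarrow>
    transpose_mat (rat_mat M_A) *\<^sub>v y1 + transpose_mat (rat_mat K_A) *\<^sub>v y2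
      = transpose_mat (rat_mat M_C) *\<^sub>v u \<and>
    transpose_mat (rat_mat M_B) *\<^sub>v y1 +
      (transpose_mat (rat_mat M_D) *\<^sub>v u + transpose_mat (rat_mat K_D) *\<^sub>v w) = 0\<^sub>v lD"
proof -
  have rows: "transpose_mat (rat_mat (M @\<^sub>r K)) *\<^sub>v (a @\<^sub>v b)
      = transpose_mat (rat_mat M) *\<^sub>v a + transpose_mat (rat_mat K) *\<^sub>v b"
    if "M \<in> carrier_mat r l" "K \<in> carrier_mat k l" "a \<in> carrier_vec r" "b \<in> carrier_vec k"
    for M K :: "'a poly mat" and r l k a b
    unfolding rat_mat_append_rows[OF that(1,2)]
    by (rule transpose_append_rows_mult_vec[of _ r l _ k]) (use that in auto)
  have zero: "v + transpose_mat (rat_mat (0\<^sub>m k l)) *\<^sub>v b = v"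
    if "v \<in> carrier_vec l" "b \<in> carrier_vec k" for k l v b
    using that by (intro eq_vecI) (auto simp: scalar_prod_def)
  note carr = transpose_rat_mult_carrier
  have "y1 @\<^sub>v y2 \<in> carrier_vec (n + kA)" "u @\<^sub>v w \<in> carrier_vec (p + kD)"
    using assms by auto
  note iff = left_nullspace_polynomial_system_matrix[OF L_carriers this]
  show ?thesis unfolding iff
      rows[OF M_A(1) K_A(1) y1 y2] rows[OF M_D(1) K_D(1) u w]
      rows[OF M_B(1) zero_carrier_mat y1 y2] rows[OF M_C(1) zero_carrier_mat u w]
      zero[OF carr[OF M_B(1)] y2] zero[OF carr[OF M_C(1)] w] ..
qed

text \<open>
  Multiplication by \<open>N_A\<^sup>T\<close> and \<open>N_D\<^sup>T\<close> removes the blocks \<open>K_A\<close> and \<open>K_D\<close> and turns the pencils into the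
  original matrices.
\<close>

lemma compress:
  assumes y1: "y1 \<in> carrier_vec n" and y2: "y2 \<in> carrier_vec kA"
    and u: "u \<in> carrier_vec p" and w: "w \<in> carrier_vec kD"
    and z: "(y1 @\<^sub>v y2) @\<^sub>v (u @\<^sub>v w) \<in> left_nullspace (rat_mat L)"
  shows "transpose_mat (rat_mat A) *\<^sub>v y1 = transpose_mat (rat_mat C) *\<^sub>v u"
    and "transpose_mat (rat_mat B) *\<^sub>v y1 + transpose_mat (rat_mat D) *\<^sub>v u = 0\<^sub>v m"
proof -
  note carr = transpose_rat_mult_carrier
  have rN: "rat_mat N_A \<in> carrier_mat n lA" "rat_mat N_D \<in> carrier_mat m lD" using N_A N_D by auto
  note z = z[unfolded left_nullspace_L_iff[OF y1 y2 u w]]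
  have "transpose_mat (rat_mat A) *\<^sub>v y1 + 0\<^sub>v n = rat_mat N_A *\<^sub>v
      (transpose_mat (rat_mat M_A) *\<^sub>v y1 + transpose_mat (rat_mat K_A) *\<^sub>v y2)"
    unfolding mult_add_distrib_mat_vec[OF rN(1) carr[OF M_A(1)] carr[OF K_A(1)]]
      rat_mult_transpose_mult_vec[OF M_A(1) N_A y1] rat_mult_dual_eq_zero[OF K_A(1) N_A y2 KN_A] M_A(3) ..
  also have "\<dots> = transpose_mat (rat_mat C) *\<^sub>v u"
    unfolding conjunct1[OF z] rat_mult_transpose_mult_vec[OF M_C(1) N_A u] M_C(3) ..
  finally show "transpose_mat (rat_mat A) *\<^sub>v y1 = transpose_mat (rat_mat C) *\<^sub>v u"
    using carr[OF A(1)] by simp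
  have "transpose_mat (rat_mat B) *\<^sub>v y1 + (transpose_mat (rat_mat D) *\<^sub>v u + 0\<^sub>v m) = rat_mat N_D *\<^sub>v
      (transpose_mat (rat_mat M_B) *\<^sub>v y1 +
        (transpose_mat (rat_mat M_D) *\<^sub>v u + transpose_mat (rat_mat K_D) *\<^sub>v w))"
    unfolding mult_add_distrib_mat_vec[OF rN(2) carr[OF M_B(1)] add_carrier_vec[OF carr[OF M_D(1)] carr[OF K_D(1)]]]
      mult_add_distrib_mat_vec[OF rN(2) carr[OF M_D(1)] carr[OF K_D(1)]]
      rat_mult_transpose_mult_vec[OF M_B(1) N_D y1] rat_mult_transpose_mult_vec[OF M_D(1) N_D u] rat_mult_dual_eq_zero[OF K_D(1) N_D w KN_D] M_B(3) M_D(3) ..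
  also have "\<dots> = 0\<^sub>v m" unfolding conjunct2[OF z] using N_D by (intro eq_vecI) auto
  finally show "transpose_mat (rat_mat B) *\<^sub>v y1 + transpose_mat (rat_mat D) *\<^sub>v u = 0\<^sub>v m"
    using carr[OF D] by simp
qed

lemma left_kernel_A:
  assumes "y \<in> carrier_vec n" "transpose_mat (rat_mat A) *\<^sub>v y = 0\<^sub>v n"
  shows "y = 0\<^sub>v n"
proof -
  interpret hom: comm_ring_hom "to_fract :: 'a poly \<Rightarrow> _" by unfold_locales auto
  have "det (transpose_mat (rat_mat A)) = to_fract (det A)"
    using det_transpose[of "rat_mat A" n] A(1) by simp
  hence "det (transpose_mat (rat_mat A)) \<noteq> 0" using A(2) by (simp add: regular_mat_def)
  thus ?thesis
    using det_0_iff_vec_prod_zero_field[of "transpose_mat (rat_mat A)" n] assms A(1) by auto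
qed

lemma left_kernel_K:
  assumes "minimal_basis_mat K" "K \<in> carrier_mat k l" "y \<in> carrier_vec k" "transpose_mat (rat_mat K) *\<^sub>v y = 0\<^sub>v l"
  shows "y = 0\<^sub>v k"
  using full_row_rank_rat_mat[OF assms(2,1)] assms by (simp add: full_row_rank_def)

text \<open>
  Injectivity of the projection onto \<open>u\<close>: regularity of \<open>A\<close> forces \<open>y1 = 0\<close>, and then the independent
  rows of \<open>K_A\<close> and \<open>K_D\<close> force \<open>y2 = 0\<close> and \<open>w = 0\<close>.
\<close>

lemma left_nullspace_L_zero:
  assumes y1: "y1 \<in> carrier_vec n" and y2: "y2 \<in> carrier_vec kA" and w: "w \<in> carrier_vec kD"
    and z: "(y1 @\<^sub>v y2) @\<^sub>v (0\<^sub>v p @\<^sub>v w) \<in> left_nullspace (rat_mat L)"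
  shows "y1 = 0\<^sub>v n" "y2 = 0\<^sub>v kA" "w = 0\<^sub>v kD"
proof -
  have zero: "transpose_mat (rat_mat M) *\<^sub>v 0\<^sub>v r = 0\<^sub>v l"
    if "M \<in> carrier_mat r l" for M :: "'a poly mat" and r l
    using that by (intro eq_vecI) auto
  note carr = transpose_rat_mult_carrier
  note eqs = z[unfolded left_nullspace_L_iff[OF y1 y2 zero_carrier_vec w] zero[OF M_C(1)] zero[OF M_D(1)]]
  show y1_0: "y1 = 0\<^sub>v n"
    using compress(1)[OF y1 y2 zero_carrier_vec w z] zero[OF C] by (intro left_kernel_A[OF y1]) simp
  have "transpose_mat (rat_mat K_A) *\<^sub>v y2 = 0\<^sub>v lA"
    using conjunct1[OF eqs] carr[OF K_A(1)] unfolding y1_0 zero[OF M_A(1)] by simp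
  thus "y2 = 0\<^sub>v kA" by (rule left_kernel_K[OF min_A K_A(1) y2])
  have "transpose_mat (rat_mat K_D) *\<^sub>v w = 0\<^sub>v lD"
    using conjunct2[OF eqs] carr[OF K_D(1)] unfolding y1_0 zero[OF M_B(1)] by simp
  thus "w = 0\<^sub>v kD" by (rule left_kernel_K[OF min_D K_D(1) w])
qed

lemma square_L_A: "L_A \<in> carrier_mat (n + kA) (n + kA)"
  using L_carriers(1) lA by (simp add: add.commute)

text \<open>
  Compressing a left kernel vector of \<open>L_A\<close> with \<open>N_A\<^sup>T\<close> yields a left kernel vector of \<open>A\<close>.
\<close>

lemma regular_L_A: "regular_mat L_A"
proof -
  interpret hom: comm_ring_hom "to_fract :: 'a poly \<Rightarrow> _" by unfold_locales auto
  have "det (transpose_mat (rat_mat L_A)) \<noteq> 0"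
  proof
    assume "det (transpose_mat (rat_mat L_A)) = 0"
    then obtain y where y: "y \<in> carrier_vec (n + kA)" "y \<noteq> 0\<^sub>v (n + kA)"
      "transpose_mat (rat_mat L_A) *\<^sub>v y = 0\<^sub>v (n + kA)"
      using det_0_iff_vec_prod_zero_field[of "transpose_mat (rat_mat L_A)" "n + kA"] square_L_A by auto
    define y1 y2 where "y1 = vec_first y n" and "y2 = vec_last y kA"
    have y12: "y1 \<in> carrier_vec n" "y2 \<in> carrier_vec kA" "y = y1 @\<^sub>v y2"
      using y(1) by (simp_all add: y1_def y2_def)
    have lA': "n + kA = lA" using lA by simp
    have eq: "transpose_mat (rat_mat M_A) *\<^sub>v y1 + transpose_mat (rat_mat K_A) *\<^sub>v y2 = 0\<^sub>v lA"
      using y(3) transpose_append_rows_mult_vec[of "rat_mat M_A" n lA "rat_mat K_A" kA y1 y2] M_A(1) K_A(1) y12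
      by (simp add: rat_mat_append_rows[OF M_A(1) K_A(1)] lA')
    have rN: "rat_mat N_A \<in> carrier_mat n lA" using N_A by simp
    note carr = transpose_rat_mult_carrier
    have "transpose_mat (rat_mat A) *\<^sub>v y1 + 0\<^sub>v n = rat_mat N_A *\<^sub>v 0\<^sub>v lA"
      unfolding eq[symmetric] mult_add_distrib_mat_vec[OF rN(1) carr[OF M_A(1)] carr[OF K_A(1)]]
        rat_mult_transpose_mult_vec[OF M_A(1) N_A y12(1)] rat_mult_dual_eq_zero[OF K_A(1) N_A y12(2) KN_A] M_A(3) ..
    also have "\<dots> = 0\<^sub>v n" using N_A by (intro eq_vecI) auto
    finally have y1_0: "y1 = 0\<^sub>v n" using carr[OF A(1)] by (intro left_kernel_A[OF y12(1)]) simp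
    have "transpose_mat (rat_mat M_A) *\<^sub>v y1 = 0\<^sub>v lA" unfolding y1_0 using M_A(1) by (intro eq_vecI) auto
    hence "transpose_mat (rat_mat K_A) *\<^sub>v y2 = 0\<^sub>v lA" using eq carr[OF K_A(1)] by simp
    hence "y2 = 0\<^sub>v kA" by (rule left_kernel_K[OF min_A K_A(1) y12(2)])
    hence "y = 0\<^sub>v (n + kA)" using y12 y1_0 by (intro eq_vecI) auto
    thus False using y(2) by simp
  qed
  hence "det (rat_mat L_A) \<noteq> 0" using det_transpose[of "rat_mat L_A" "n + kA"] square_L_A by simp
  hence "det L_A \<noteq> 0" by auto
  thus ?thesis using square_L_A by (auto simp: regular_mat_def)
qed

text \<open>
  Both rank conditions enter here. The entries of \<open>A\<close> and \<open>C\<close> have degree at most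
  \<open>mat_degree N_A + 1\<close>, those of \<open>B\<close> and \<open>D\<close> at most \<open>mat_degree N_D + 1\<close>, so the right-hand side
  \<open>[u\<^sup>T C, - u\<^sup>T D]\<close> exceeds the degree of \<open>u\<close> by no more than the column degree bounds of \<open>[A B]\<close>.
\<close>

lemma lift_to_state:
  assumes u: "u \<in> carrier_vec p" "rat_vec u \<in> left_nullspace R"
  shows "\<exists>y1 \<in> carrier_vec n. vec_degree y1 \<le> vec_degree u \<and>
    transpose_mat A *\<^sub>v y1 = transpose_mat C *\<^sub>v u \<and>
    transpose_mat B *\<^sub>v y1 = - (transpose_mat D *\<^sub>v u)"
proof -
  let ?G = "append_cols A B" and ?b = "(transpose_mat C *\<^sub>v u) @\<^sub>v - (transpose_mat D *\<^sub>v u)"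
  have G: "?G \<in> carrier_mat n (n + m)" using A(1) B by simp
  have T: "transpose_mat A \<in> carrier_mat n n" "transpose_mat B \<in> carrier_mat m n"
    "transpose_mat C \<in> carrier_mat n p" "transpose_mat D \<in> carrier_mat m p" using A(1) B C D by auto
  obtain y where y: "y \<in> carrier_vec n"
    "transpose_mat (rat_mat A) *\<^sub>v y = transpose_mat (rat_mat C) *\<^sub>v rat_vec u"
    "transpose_mat (rat_mat B) *\<^sub>v y + transpose_mat (rat_mat D) *\<^sub>v rat_vec u = 0\<^sub>v m"
    using left_nullspace_transfer_function(2)[OF A B C D, of "rat_vec u"] u by auto
  have "transpose_mat (rat_mat B) *\<^sub>v y = - (transpose_mat (rat_mat D) *\<^sub>v rat_vec u)"
  proof (rule eq_vecI)
    fix i assume "i < dim_vec (- (transpose_mat (rat_mat D) *\<^sub>v rat_vec u))"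
    hence i: "i < m" using D by simp
    have "(transpose_mat (rat_mat B) *\<^sub>v y + transpose_mat (rat_mat D) *\<^sub>v rat_vec u) $ i = 0"
      unfolding y(3) using i by simp
    hence "(transpose_mat (rat_mat B) *\<^sub>v y) $ i + (transpose_mat (rat_mat D) *\<^sub>v rat_vec u) $ i = 0"
      using i D by (simp del: index_mult_mat_vec)
    thus "(transpose_mat (rat_mat B) *\<^sub>v y) $ i = (- (transpose_mat (rat_mat D) *\<^sub>v rat_vec u)) $ i"
      using i D by (simp del: index_mult_mat_vec add: eq_neg_iff_add_eq_0)
  qed (use B D in simp)
  also have "\<dots> = rat_vec (- (transpose_mat D *\<^sub>v u))"
    unfolding map_mat_transpose rat_mult_mat_vec[OF T(4) u(1), symmetric] by (intro eq_vecI) auto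
  finally have yB: "transpose_mat (rat_mat B) *\<^sub>v y = rat_vec (- (transpose_mat D *\<^sub>v u))" .
  have yA: "transpose_mat (rat_mat A) *\<^sub>v y = rat_vec (transpose_mat C *\<^sub>v u)"
    unfolding rat_mult_mat_vec[OF T(3) u(1)] y(2) by (simp only: map_mat_transpose)
  have ratG: "rat_mat ?G = append_cols (rat_mat A) (rat_mat B)"
    using A(1) B by (intro eq_matI) (auto simp: append_cols_def)
  have "transpose_mat (rat_mat ?G) *\<^sub>v y = rat_vec ?b"
    unfolding ratG rat_vec_append yA[symmetric] yB[symmetric]
    by (rule transpose_append_cols_mult_vec) (use A(1) B y(1) in auto)
  moreover have "eval_poly_mat ?G x = append_cols (eval_poly_mat A x) (eval_poly_mat B x)" for x
    using A(1) B by (intro eq_matI) (auto simp: append_cols_def eval_poly_mat_def)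
  hence "full_row_rank (eval_poly_mat ?G x)" for x using rank_finite[of x] by simp
  ultimately obtain y1 where y1: "y1 \<in> carrier_vec n" "y = rat_vec y1"
    using polynomial_of_full_row_rank[OF G _ y(1)] by blast
  have "rat_vec (transpose_mat A *\<^sub>v y1) = rat_vec (transpose_mat C *\<^sub>v u)"
    unfolding yA[symmetric] y1(2) map_mat_transpose by (rule rat_mult_mat_vec[OF T(1) y1(1)])
  hence A_eq: "transpose_mat A *\<^sub>v y1 = transpose_mat C *\<^sub>v u" by simp
  have "rat_vec (transpose_mat B *\<^sub>v y1) = rat_vec (- (transpose_mat D *\<^sub>v u))"
    unfolding yB[symmetric] y1(2) map_mat_transpose by (rule rat_mult_mat_vec[OF T(2) y1(1)])
  hence B_eq: "transpose_mat B *\<^sub>v y1 = - (transpose_mat D *\<^sub>v u)" by simp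
  let ?g = "\<lambda>j. if j < n then mat_degree N_A + 1 else mat_degree N_D + 1"
  have lin: "degree (M $$ (i, j)) \<le> 1" if "linear_poly_mat M" "M \<in> carrier_mat r l" "i < r" "j < l"
    for M :: "'a poly mat" and r l i j
    using that by (auto simp: linear_poly_mat_def)
  have dA: "degree (A $$ (i, j)) \<le> mat_degree N_A + 1" if "i < n" "j < n" for i j
    using degree_linear_mult_transpose_le[OF M_A(1) lin[OF M_A(2,1)] N_A that] unfolding M_A(3) .
  have dB: "degree (B $$ (i, j)) \<le> mat_degree N_D + 1" if "i < n" "j < m" for i j
    using degree_linear_mult_transpose_le[OF M_B(1) lin[OF M_B(2,1)] N_D that] unfolding M_B(3) .
  have dC: "degree (C $$ (i, j)) \<le> mat_degree N_A + 1" if "i < p" "j < n" for i j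
    using degree_linear_mult_transpose_le[OF M_C(1) lin[OF M_C(2,1)] N_A that] unfolding M_C(3) .
  have dD: "degree (D $$ (i, j)) \<le> mat_degree N_D + 1" if "i < p" "j < m" for i j
    using degree_linear_mult_transpose_le[OF M_D(1) lin[OF M_D(2,1)] N_D that] unfolding M_D(3) .
  have "vec_degree y1 \<le> vec_degree u"
  proof (rule vec_degree_of_full_row_rank[OF G, where g = ?g])
    show "degree (?G $$ (i, j)) \<le> ?g j" if "i < n" "j < n + m" for i j
      using dA[of i j] dB[of i "j - n"] that by (simp add: append_cols_index[OF A(1) B])
    have "coeff_mat ?g ?G = append_cols (coeff_mat (\<lambda>_. mat_degree N_A + 1) A)
        (coeff_mat (\<lambda>_. mat_degree N_D + 1) B)"
      using A(1) B by (intro eq_matI) (auto simp: append_cols_def coeff_mat_def)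
    thus "full_row_rank (coeff_mat ?g ?G)" using rank_infinite by simp
    have dCu: "vec_degree (transpose_mat C *\<^sub>v u) \<le> vec_degree u + (mat_degree N_A + 1)"
      by (rule vec_degree_mult_mat_vec_le[OF T(3) u(1) order_refl]) (use C dC in auto)
    have dDu: "vec_degree (- (transpose_mat D *\<^sub>v u)) \<le> vec_degree u + (mat_degree N_D + 1)"
      unfolding vec_degree_uminus
      by (rule vec_degree_mult_mat_vec_le[OF T(4) u(1) order_refl]) (use D dD in auto)
    have mult: "transpose_mat ?G *\<^sub>v y1 = ?b"
      unfolding transpose_append_cols_mult_vec[OF A(1) B y1(1)] A_eq B_eq ..
    show "degree ((transpose_mat ?G *\<^sub>v y1) $ j) \<le> vec_degree u + ?g j" if j: "j < n + m" for j
    proof (cases "j < n")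
      case True
      have "degree ((transpose_mat C *\<^sub>v u) $ j) \<le> vec_degree u + (mat_degree N_A + 1)"
        using degree_le_vec_degree[of j "transpose_mat C *\<^sub>v u"] dCu True C by (simp del: index_mult_mat_vec)
      moreover have "?b $ j = (transpose_mat C *\<^sub>v u) $ j"
        using True j C D by (simp del: index_mult_mat_vec)
      ultimately show ?thesis using True by (simp only: mult if_True)
    next
      case False
      hence jm: "j - n < m" using j by simp
      have "degree ((- (transpose_mat D *\<^sub>v u)) $ (j - n)) \<le> vec_degree u + (mat_degree N_D + 1)"
      proof -
        have "j - n < dim_vec (- (transpose_mat D *\<^sub>v u))" using jm D by simp
        from degree_le_vec_degree[OF this] dDu show ?thesis by (rule order_trans)
      qed
      moreover have "?b $ j = (- (transpose_mat D *\<^sub>v u)) $ (j - n)"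
        using False j C D by (simp del: index_mult_mat_vec index_uminus_vec(1))
      ultimately show ?thesis using False by (simp only: mult if_False)
    qed
  qed (rule y1(1))
  thus ?thesis using y1(1) A_eq B_eq by blast
qed

text \<open>
  The remaining blocks \<open>y2\<close> and \<open>w\<close> are obtained from the duality of \<open>K_A\<close>, \<open>N_A\<close> and of \<open>K_D\<close>, \<open>N_D\<close>.
  The degree 1 that the linear blocks add is saved again in these two steps.
\<close>

lemma lift_to_L:
  assumes u: "u \<in> carrier_vec p" "rat_vec u \<in> left_nullspace R"
  shows "\<exists>y1 \<in> carrier_vec n. \<exists>y2 \<in> carrier_vec kA. \<exists>w \<in> carrier_vec kD.
    rat_vec ((y1 @\<^sub>v y2) @\<^sub>v (u @\<^sub>v w)) \<in> left_nullspace (rat_mat L) \<and>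
    vec_degree ((y1 @\<^sub>v y2) @\<^sub>v (u @\<^sub>v w)) \<le> vec_degree u"
proof -
  let ?d = "vec_degree u"
  obtain y1 where y1: "y1 \<in> carrier_vec n" "vec_degree y1 \<le> ?d"
    and A_eq: "transpose_mat A *\<^sub>v y1 = transpose_mat C *\<^sub>v u"
    and B_eq: "transpose_mat B *\<^sub>v y1 = - (transpose_mat D *\<^sub>v u)"
    using lift_to_state[OF u] by blast
  have carr: "transpose_mat M *\<^sub>v v \<in> carrier_vec l"
    if "M \<in> carrier_mat r l" for M :: "'a poly mat" and r l v
    using that by (intro carrier_vecI) simp
  have deg: "vec_degree (transpose_mat M *\<^sub>v v) \<le> ?d + 1"
    if "linear_poly_mat M" "M \<in> carrier_mat r l" "v \<in> carrier_vec r" "vec_degree v \<le> ?d"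
    for M :: "'a poly mat" and r l v
    by (rule vec_degree_mult_mat_vec_le[of _ l r]) (use that in \<open>auto simp: linear_poly_mat_def\<close>)
  let ?v = "transpose_mat M_C *\<^sub>v u + - (transpose_mat M_A *\<^sub>v y1)"
  have v: "?v \<in> carrier_vec lA" using carr[OF M_C(1)] carr[OF M_A(1)] by simp
  have "N_A *\<^sub>v ?v = transpose_mat C *\<^sub>v u + - (transpose_mat A *\<^sub>v y1)"
    unfolding mult_add_distrib_mat_vec[OF N_A carr[OF M_C(1)] uminus_carrier_vec[THEN iffD2, OF carr[OF M_A(1)]]]
      mult_mat_vec_uminus[OF N_A carr[OF M_A(1)]] mult_transpose_mult_vec[OF M_C(1) N_A u(1)]
      mult_transpose_mult_vec[OF M_A(1) N_A y1(1)] M_A(3) M_C(3) ..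
  also have "\<dots> = 0\<^sub>v n" unfolding A_eq using C by (intro eq_vecI) (auto simp del: index_mult_mat_vec)
  finally have Nv: "N_A *\<^sub>v ?v = 0\<^sub>v (dim_row N_A)" using N_A by simp
  have dv: "vec_degree ?v \<le> ?d + 1"
    using deg[OF M_C(2,1) u(1)] deg[OF M_A(2,1) y1] M_A(1) M_C(1) by (intro vec_degree_add_le) auto
  obtain y2 where y2: "y2 \<in> carrier_vec kA" "transpose_mat K_A *\<^sub>v y2 = ?v" "vec_degree y2 \<le> ?d"
    using dual_minimal_bases_lift[OF K_A v Nv dv] by blast
  let ?w = "- (transpose_mat M_B *\<^sub>v y1 + transpose_mat M_D *\<^sub>v u)"
  have w': "?w \<in> carrier_vec lD" using carr[OF M_B(1)] carr[OF M_D(1)] by simp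
  have "N_D *\<^sub>v ?w = - (transpose_mat B *\<^sub>v y1 + transpose_mat D *\<^sub>v u)"
    unfolding mult_mat_vec_uminus[OF N_D add_carrier_vec[OF carr[OF M_B(1)] carr[OF M_D(1)]]]
      mult_add_distrib_mat_vec[OF N_D carr[OF M_B(1)] carr[OF M_D(1)]]
      mult_transpose_mult_vec[OF M_B(1) N_D y1(1)] mult_transpose_mult_vec[OF M_D(1) N_D u(1)] M_B(3) M_D(3) ..
  also have "\<dots> = 0\<^sub>v m" unfolding B_eq using D by (intro eq_vecI) (auto simp del: index_mult_mat_vec)
  finally have Nw: "N_D *\<^sub>v ?w = 0\<^sub>v (dim_row N_D)" using N_D by simp
  have dw: "vec_degree ?w \<le> ?d + 1" unfolding vec_degree_uminus
    using deg[OF M_D(2,1) u(1)] deg[OF M_B(2,1) y1] M_B(1) M_D(1) by (intro vec_degree_add_le) auto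
  obtain w where w: "w \<in> carrier_vec kD" "transpose_mat K_D *\<^sub>v w = ?w" "vec_degree w \<le> ?d"
    using dual_minimal_bases_lift[OF K_D w' Nw dw] by blast
  let ?z = "(y1 @\<^sub>v y2) @\<^sub>v (u @\<^sub>v w)"
  have rat: "transpose_mat (rat_mat M) *\<^sub>v rat_vec v = rat_vec (transpose_mat M *\<^sub>v v)"
    if "M \<in> carrier_mat r l" "v \<in> carrier_vec r" for M :: "'a poly mat" and r l v
    unfolding map_mat_transpose by (rule rat_mult_mat_vec[symmetric, of _ l r]) (use that in auto)
  have "rat_vec (transpose_mat M_A *\<^sub>v y1) + rat_vec ?v = rat_vec (transpose_mat M_C *\<^sub>v u)"
    using M_A(1) M_C(1) by (intro eq_vecI) (auto simp del: index_mult_mat_vec)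
  moreover have "rat_vec (transpose_mat M_B *\<^sub>v y1) + (rat_vec (transpose_mat M_D *\<^sub>v u) + rat_vec ?w) = 0\<^sub>v lD"
    using M_B(1) M_D(1) by (intro eq_vecI) (auto simp del: index_mult_mat_vec)
  ultimately have "rat_vec ?z \<in> left_nullspace (rat_mat L)"
    unfolding rat_vec_append
    using left_nullspace_L_iff[of "rat_vec y1" "rat_vec y2" "rat_vec u" "rat_vec w"] y1 y2 u w
    by (simp add: rat[OF M_A(1)] rat[OF M_B(1)] rat[OF M_C(1)] rat[OF M_D(1)] rat[OF K_A(1)] rat[OF K_D(1)])
  moreover have "vec_degree ?z \<le> ?d" using y1 y2 w by (intro vec_degree_append_le) auto
  ultimately show ?thesis using y1 y2 w by blast
qed

lemma L_carrier: "rat_mat L \<in> carrier_mat (n + kA + (p + kD)) (lA + lD)"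
  using L_carriers by (simp add: polynomial_system_matrix_def)

lemma R_carrier: "R \<in> carrier_mat p m"
  by (rule left_nullspace_transfer_function(1)[OF A B C D])

lemma L_carriers_square: "L_C \<in> carrier_mat (p + kD) (n + kA)"
  using L_carriers(3) lA by (simp add: add.commute)

lemma R_hat_carrier: "R_hat \<in> carrier_mat (p + kD) lD"
  by (rule left_nullspace_transfer_function(1)
      [OF square_L_A regular_L_A L_carriers(2) L_carriers_square L_carriers(4)])

lemma split_L:
  assumes "z \<in> carrier_vec (n + kA + (p + kD))"
  obtains y1 y2 u w where "y1 \<in> carrier_vec n" "y2 \<in> carrier_vec kA"
    "u \<in> carrier_vec p" "w \<in> carrier_vec kD" "z = (y1 @\<^sub>v y2) @\<^sub>v (u @\<^sub>v w)"
proof -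
  let ?y = "vec_first z (n + kA)" and ?x = "vec_last z (p + kD)"
  have "z = ?y @\<^sub>v ?x" using assms by simp
  moreover have "?y = vec_first ?y n @\<^sub>v vec_last ?y kA" by simp
  moreover have "?x = vec_first ?x p @\<^sub>v vec_last ?x kD" by simp
  ultimately show thesis using that vec_first_carrier vec_last_carrier by metis
qed

lemma slice_split:
  assumes "y1 \<in> carrier_vec n" "y2 \<in> carrier_vec kA" "u \<in> carrier_vec p" "w \<in> carrier_vec kD"
  shows "vec_slice (n + kA) p ((y1 @\<^sub>v y2) @\<^sub>v (u @\<^sub>v w)) = u"
    and "vec_slice (n + kA) (p + kD) ((y1 @\<^sub>v y2) @\<^sub>v (u @\<^sub>v w)) = u @\<^sub>v w"
proof -
  have y: "y1 @\<^sub>v y2 \<in> carrier_vec (n + kA)" and x: "u @\<^sub>v w \<in> carrier_vec (p + kD)" using assms by auto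
  show "vec_slice (n + kA) p ((y1 @\<^sub>v y2) @\<^sub>v (u @\<^sub>v w)) = u"
    by (rule vec_slice_append(2)[OF y assms(3)])
  show "vec_slice (n + kA) (p + kD) ((y1 @\<^sub>v y2) @\<^sub>v (u @\<^sub>v w)) = u @\<^sub>v w"
    by (rule vec_slice_append(1)[OF y x])
qed

lemma in_left_nullspace_L:
  assumes "z \<in> left_nullspace (rat_mat L)"
  shows "z \<in> carrier_vec (n + kA + (p + kD))"
  using assms left_nullspace_iff[OF L_carrier] by blast

section \<open>Transfer of minimal bases\<close>

lemma slice_R:
  "degree_preserving_slice (n + kA + (p + kD)) p (n + kA) (left_nullspace (rat_mat L)) (left_nullspace R)"
proof (rule degree_preserving_slice.intro)
  show "submodule class_ring (left_nullspace (rat_mat L))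
      (module_vec TYPE('a poly fract) (n + kA + (p + kD)))"
    using submodule_left_nullspace[of "rat_mat L"] unfolding carrier_matD[OF L_carrier] .
  show "submodule class_ring (left_nullspace R) (module_vec TYPE('a poly fract) p)"
    using submodule_left_nullspace[of R] unfolding carrier_matD[OF R_carrier] .
  show "n + kA + p \<le> n + kA + (p + kD)" by simp
next
  fix z assume z: "z \<in> left_nullspace (rat_mat L)"
  obtain y1 y2 u w where c: "y1 \<in> carrier_vec n" "y2 \<in> carrier_vec kA"
    "u \<in> carrier_vec p" "w \<in> carrier_vec kD" and z_eq: "z = (y1 @\<^sub>v y2) @\<^sub>v (u @\<^sub>v w)"
    by (rule split_L[OF in_left_nullspace_L[OF z]])
  show "vec_slice (n + kA) p z \<in> left_nullspace R"
    unfolding z_eq slice_split(1)[OF c] left_nullspace_transfer_function(2)[OF A B C D c(3)]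
    using compress[OF c z[unfolded z_eq]] c(1) by blast
  assume "vec_slice (n + kA) p z = 0\<^sub>v p"
  hence u0: "u = 0\<^sub>v p" unfolding z_eq slice_split(1)[OF c] .
  show "z = 0\<^sub>v (n + kA + (p + kD))"
    unfolding z_eq u0 left_nullspace_L_zero[OF c(1,2,4) z[unfolded z_eq u0]] by (intro eq_vecI) auto
next
  fix u :: "'a poly vec" assume u: "u \<in> carrier_vec p" "rat_vec u \<in> left_nullspace R"
  then obtain y1 y2 w where c: "y1 \<in> carrier_vec n" "y2 \<in> carrier_vec kA" "w \<in> carrier_vec kD"
    and z: "rat_vec ((y1 @\<^sub>v y2) @\<^sub>v (u @\<^sub>v w)) \<in> left_nullspace (rat_mat L)"
      "vec_degree ((y1 @\<^sub>v y2) @\<^sub>v (u @\<^sub>v w)) \<le> vec_degree u"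
    using lift_to_L by blast
  have "(y1 @\<^sub>v y2) @\<^sub>v (u @\<^sub>v w) \<in> carrier_vec (n + kA + (p + kD))" using c u by auto
  with z slice_split(1)[OF c(1,2) u(1) c(3)]
  show "\<exists>v \<in> carrier_vec (n + kA + (p + kD)). rat_vec v \<in> left_nullspace (rat_mat L) \<and>
      vec_slice (n + kA) p v = u \<and> vec_degree v \<le> vec_degree u" by blast
qed

text \<open>
  A polynomial \<open>x = (u, w)\<close> in the left nullspace of \<open>R_hat\<close> extends to a rational vector in that of
  \<open>L\<close>. Since this extension is determined by \<open>u\<close>, it is the polynomial lift of \<open>u\<close>.
\<close>

lemma slice_R_hat:
  "degree_preserving_slice (n + kA + (p + kD)) (p + kD) (n + kA) (left_nullspace (rat_mat L)) (left_nullspace R_hat)"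
proof -
  interpret R: degree_preserving_slice "n + kA + (p + kD)" p "n + kA" "left_nullspace (rat_mat L)" "left_nullspace R"
    by (rule slice_R)
  have y_carr: "y1 @\<^sub>v y2 \<in> carrier_vec (n + kA)"
    if "y1 \<in> carrier_vec n" "y2 \<in> carrier_vec kA" for y1 y2 :: "'a poly fract vec"
    using that by auto
  have x_carr: "u @\<^sub>v w \<in> carrier_vec (p + kD)"
    if "u \<in> carrier_vec p" "w \<in> carrier_vec kD" for u w :: "'a poly fract vec"
    using that by auto
  note transfer = left_nullspace_transfer_function(2)
    [OF square_L_A regular_L_A L_carriers(2) L_carriers_square L_carriers(4)]
  note system = left_nullspace_polynomial_system_matrix
    [OF square_L_A L_carriers(2) L_carriers_square L_carriers(4)]
  show ?thesis
  proof (rule degree_preserving_slice.intro)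
    show "submodule class_ring (left_nullspace (rat_mat L))
        (module_vec TYPE('a poly fract) (n + kA + (p + kD)))" by (rule R.V)
    show "submodule class_ring (left_nullspace R_hat) (module_vec TYPE('a poly fract) (p + kD))"
      using submodule_left_nullspace[of R_hat] unfolding carrier_matD[OF R_hat_carrier] .
    show "n + kA + (p + kD) \<le> n + kA + (p + kD)" by simp
  next
    fix z assume z: "z \<in> left_nullspace (rat_mat L)"
    obtain y1 y2 u w where c: "y1 \<in> carrier_vec n" "y2 \<in> carrier_vec kA"
      "u \<in> carrier_vec p" "w \<in> carrier_vec kD" and z_eq: "z = (y1 @\<^sub>v y2) @\<^sub>v (u @\<^sub>v w)"
      by (rule split_L[OF in_left_nullspace_L[OF z]])
    show "vec_slice (n + kA) (p + kD) z \<in> left_nullspace R_hat"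
      unfolding z_eq slice_split(2)[OF c] transfer[OF x_carr[OF c(3,4)]]
      using z[unfolded z_eq system[OF y_carr[OF c(1,2)] x_carr[OF c(3,4)]]] y_carr[OF c(1,2)] by blast
    assume 0: "vec_slice (n + kA) (p + kD) z = 0\<^sub>v (p + kD)"
    have "u @\<^sub>v w = 0\<^sub>v (p + kD)" using 0 unfolding z_eq slice_split(2)[OF c] .
    also have "\<dots> = 0\<^sub>v p @\<^sub>v 0\<^sub>v kD" by (intro eq_vecI) auto
    finally have "u @\<^sub>v w = 0\<^sub>v p @\<^sub>v 0\<^sub>v kD" .
    hence "u = 0\<^sub>v p" using c(3) by simp
    hence "vec_slice (n + kA) p z = 0\<^sub>v p" unfolding z_eq slice_split(1)[OF c] .
    thus "z = 0\<^sub>v (n + kA + (p + kD))" by (rule R.slice_0[OF z])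
  next
    fix x :: "'a poly vec" assume x: "x \<in> carrier_vec (p + kD)" "rat_vec x \<in> left_nullspace R_hat"
    obtain y where y: "y \<in> carrier_vec (n + kA)" "y @\<^sub>v rat_vec x \<in> left_nullspace (rat_mat L)"
      using x transfer[of "rat_vec x"] system[of _ "rat_vec x"] by auto
    define u w where "u = vec_first x p" and "w = vec_last x kD"
    have uw: "u \<in> carrier_vec p" "w \<in> carrier_vec kD" "x = u @\<^sub>v w"
      using x(1) by (simp_all add: u_def w_def)
    have slice_y: "vec_slice (n + kA) p (y @\<^sub>v rat_vec x) = rat_vec u"
      unfolding uw(3) rat_vec_append by (rule vec_slice_append(2)[OF y(1)]) (use uw in simp)
    have "rat_vec u \<in> left_nullspace R" using R.slice_in[OF y(2)] unfolding slice_y .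
    then obtain z where z: "z \<in> carrier_vec (n + kA + (p + kD))" "rat_vec z \<in> left_nullspace (rat_mat L)"
      "vec_slice (n + kA) p z = u" "vec_degree z \<le> vec_degree u"
      using R.lift uw(1) by blast
    have "vec_slice (n + kA) p (rat_vec z) = vec_slice (n + kA) p (y @\<^sub>v rat_vec x)"
      unfolding slice_y using z(1,3) by (simp add: vec_slice_rat_vec)
    hence eq: "rat_vec z = y @\<^sub>v rat_vec x"
      using R.slice_bij z(2) y(2) by (auto simp: bij_betw_def dest: inj_onD)
    have "rat_vec (vec_slice (n + kA) (p + kD) z) = vec_slice (n + kA) (p + kD) (rat_vec z)"
      using z(1) by (simp add: vec_slice_rat_vec)
    also have "\<dots> = rat_vec x" unfolding eq by (rule vec_slice_append(1)[OF y(1)]) (use x in simp)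
    finally have "vec_slice (n + kA) (p + kD) z = x" by simp
    moreover have "degree (u $ i) \<le> vec_degree x" if "i < p" for i
      using degree_le_vec_degree[of i x] that uw by simp
    hence "vec_degree u \<le> vec_degree x" using uw(1) by (simp add: vec_degree_le_iff)
    ultimately show "\<exists>v \<in> carrier_vec (n + kA + (p + kD)). rat_vec v \<in> left_nullspace (rat_mat L) \<and>
        vec_slice (n + kA) (p + kD) v = x \<and> vec_degree v \<le> vec_degree x"
      using z(1,2) order_trans[OF z(4)] by blast
  qed
qed

theorem left_minimal_bases:
  assumes zs: "left_minimal_basis (rat_mat L) zs"
  shows "set zs \<subseteq> carrier_vec (n + kA + (p + kD))"
    and "left_minimal_basis R_hat (map (vec_slice (n + kA) (p + kD)) zs)"
    and "left_minimal_basis R (map (vec_slice (n + kA) p) zs)"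
    and "map vec_degree (map (vec_slice (n + kA) (p + kD)) zs) = map vec_degree zs"
    and "map vec_degree (map (vec_slice (n + kA) p) zs) = map vec_degree zs"
proof -
  interpret R: degree_preserving_slice "n + kA + (p + kD)" p "n + kA" "left_nullspace (rat_mat L)" "left_nullspace R"
    by (rule slice_R)
  interpret R_hat: degree_preserving_slice "n + kA + (p + kD)" "p + kD" "n + kA"
    "left_nullspace (rat_mat L)" "left_nullspace R_hat" by (rule slice_R_hat)
  have min: "minimal_basis (n + kA + (p + kD)) (left_nullspace (rat_mat L)) zs"
    using zs unfolding left_minimal_basis_def carrier_matD[OF L_carrier] .
  show "set zs \<subseteq> carrier_vec (n + kA + (p + kD))"
    using min polynomial_basis_in[OF R.V] by (simp add: minimal_basis_def)
  show "left_minimal_basis R_hat (map (vec_slice (n + kA) (p + kD)) zs)"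
    using R_hat.minimal_basis_slice(1)[OF min]
    unfolding left_minimal_basis_def carrier_matD[OF R_hat_carrier] .
  show "left_minimal_basis R (map (vec_slice (n + kA) p) zs)"
    using R.minimal_basis_slice(1)[OF min]
    unfolding left_minimal_basis_def carrier_matD[OF R_carrier] .
  show "map vec_degree (map (vec_slice (n + kA) (p + kD)) zs) = map vec_degree zs"
    by (rule R_hat.minimal_basis_slice(2)[OF min])
  show "map vec_degree (map (vec_slice (n + kA) p) zs) = map vec_degree zs"
    by (rule R.minimal_basis_slice(2)[OF min])
qed

end

lemma eval_rev_rat_mat_0:
  fixes P :: "'a::field poly mat"
  assumes P: "P \<in> carrier_mat nr nc" and deg: "\<And>i j. i < nr \<Longrightarrow> j < nc \<Longrightarrow> degree (P $$ (i, j)) \<le> g"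
  shows "eval_rat_mat (rev_mat (int g) (rat_mat P)) 0 = coeff_mat (\<lambda>_. g) P"
proof (rule eq_matI)
  fix i j assume "i < dim_row (coeff_mat (\<lambda>_. g) P)" "j < dim_col (coeff_mat (\<lambda>_. g) P)"
  hence ij: "i < nr" "j < nc" "i < dim_row P" "j < dim_col P" using P by (simp_all add: coeff_mat_def)
  have "eval_rat_mat (rev_mat (int g) (rat_mat P)) 0 $$ (i, j)
      = rat_eval id 0 (rat_var powi int g * rat_eval rat_const (inverse rat_var) (to_fract (P $$ (i, j))))"
    unfolding eval_rat_mat_def rev_mat_def using ij(3,4) by (simp only: index_map_mat)
  also have "\<dots> = coeff_mat (\<lambda>_. g) P $$ (i, j)"
    unfolding rev_poly_eval_0[OF deg[OF ij(1,2)]] coeff_mat_def using ij by simp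
  finally show "eval_rat_mat (rev_mat (int g) (rat_mat P)) 0 $$ (i, j) = coeff_mat (\<lambda>_. g) P $$ (i, j)" .
qed (simp_all add: eval_rat_mat_def rev_mat_def coeff_mat_def)

lemma linear_poly_mat_append_rowsD:
  assumes lin: "linear_poly_mat (M @\<^sub>r K)" and col: "dim_col M = dim_col K"
  shows "linear_poly_mat M"
  unfolding linear_poly_mat_def
proof (intro allI impI)
  fix i j assume ij: "i < dim_row M" "j < dim_col M"
  hence "(M @\<^sub>r K) $$ (i, j) = M $$ (i, j)" by (simp add: append_rows_def)
  moreover have "i < dim_row (M @\<^sub>r K)" "j < dim_col (M @\<^sub>r K)"
    using ij by (simp_all add: append_rows_def)
  ultimately show "degree (M $$ (i, j)) \<le> 1" using lin unfolding linear_poly_mat_def by metis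
qed

section \<open>Left minimal bases and indices of the linearization\<close>

theorem theorem6p10:
  fixes A B C D M_A K_A N_A M_D K_D N_D M_B M_C L :: "'a::alg_closed_field poly mat"
    and R R_hat :: "'a poly fract mat"
    and n m p \<rho>A \<rho>D :: nat
  assumes A: "A \<in> carrier_mat n n" "regular_mat A"
    and B: "B \<in> carrier_mat n m"
    and C: "C \<in> carrier_mat p n"
    and D: "D \<in> carrier_mat p m"
    and R: "R \<in> carrier_mat p m" "singular_mat R" "R = transfer_function A B C D"
    and rhoA: "\<rho>A = mat_degree N_A"
    and rhoD: "\<rho>D = mat_degree N_D"
    and L_A: "M_A \<in> carrier_mat n ((\<rho>A + 1) * n)" "K_A \<in> carrier_mat (\<rho>A * n) ((\<rho>A + 1) * n)"
      "strong_block_minimal_basis_pencil M_A K_A"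
    and L_D: "M_D \<in> carrier_mat p ((\<rho>D + 1) * m)" "K_D \<in> carrier_mat (\<rho>D * m) ((\<rho>D + 1) * m)"
      "strong_block_minimal_basis_pencil M_D K_D"
    and N_A: "dual_minimal_bases K_A N_A" "equal_row_degrees N_A" "M_A * transpose_mat N_A = A"
    and N_D: "dual_minimal_bases K_D N_D" "equal_row_degrees N_D" "M_D * transpose_mat N_D = D"
    and M_C: "M_C \<in> carrier_mat p ((\<rho>A + 1) * n)" "linear_poly_mat M_C"
      "M_C * transpose_mat N_A = C"
    and M_B: "M_B \<in> carrier_mat n ((\<rho>D + 1) * m)" "linear_poly_mat M_B"
      "M_B * transpose_mat N_D = B"
    and L: "L = polynomial_system_matrix
                  (M_A @\<^sub>r K_A) (M_B @\<^sub>r 0\<^sub>m (\<rho>A * n) ((\<rho>D + 1) * m))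
                  (M_C @\<^sub>r 0\<^sub>m (\<rho>D * m) ((\<rho>A + 1) * n)) (M_D @\<^sub>r K_D)"
    and R_hat: "R_hat = transfer_function
                  (M_A @\<^sub>r K_A) (M_B @\<^sub>r 0\<^sub>m (\<rho>A * n) ((\<rho>D + 1) * m))
                  (M_C @\<^sub>r 0\<^sub>m (\<rho>D * m) ((\<rho>A + 1) * n)) (M_D @\<^sub>r K_D)"
    and rank_finite:
      "\<forall>x::'a. vec_space.rank n (append_cols (eval_poly_mat A x) (eval_poly_mat B x)) = n"
    and rank_infinite:
      "vec_space.rank n
         (append_cols (eval_rat_mat (rev_mat (int (\<rho>A + 1)) (rat_mat A)) 0)
                      (eval_rat_mat (rev_mat (int (\<rho>D + 1)) (rat_mat B)) 0)) = n"
  shows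
    "(\<forall>zs. left_minimal_basis (rat_mat L) zs \<longrightarrow>
        (\<exists>ys xs us ws.
           length ys = length zs \<and> length xs = length zs \<and>
           length us = length zs \<and> length ws = length zs \<and>
           left_minimal_basis R_hat xs \<and> left_minimal_basis R us \<and>
           (\<forall>i<length zs.
              ys ! i \<in> carrier_vec (n + \<rho>A * n) \<and> xs ! i \<in> carrier_vec (p + \<rho>D * m) \<and>
              zs ! i = ys ! i @\<^sub>v xs ! i \<and>
              us ! i \<in> carrier_vec p \<and> ws ! i \<in> carrier_vec (\<rho>D * m) \<and>
              xs ! i = us ! i @\<^sub>v ws ! i))) \<and>
     (\<forall>\<eta>s. left_minimal_indices (rat_mat L) \<eta>s \<longrightarrow>
        left_minimal_indices R_hat \<eta>s \<and> left_minimal_indices R \<eta>s)"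
proof -
  have N_A_carr: "N_A \<in> carrier_mat n ((\<rho>A + 1) * n)"
    using N_A(1,3) A(1) L_A(2) by (auto simp: dual_minimal_bases_def)
  have N_D_carr: "N_D \<in> carrier_mat m ((\<rho>D + 1) * m)"
    using N_D(1,3) D L_D(2) by (auto simp: dual_minimal_bases_def)
  have lin_A: "linear_poly_mat M_A" and lin_D: "linear_poly_mat M_D"
    using L_A(3) L_D(3) linear_poly_mat_append_rowsD
    by (auto simp: strong_block_minimal_basis_pencil_def)
  have lin: "degree (M $$ (i, j)) \<le> 1" if "linear_poly_mat M" "M \<in> carrier_mat r l" "i < r" "j < l"
    for M :: "'a poly mat" and r l i j
    using that by (auto simp: linear_poly_mat_def)
  have rev_A: "eval_rat_mat (rev_mat (int (\<rho>A + 1)) (rat_mat A)) 0 = coeff_mat (\<lambda>_. \<rho>A + 1) A"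
  proof (rule eval_rev_rat_mat_0[OF A(1)])
    show "degree (A $$ (i, j)) \<le> \<rho>A + 1" if "i < n" "j < n" for i j
      using degree_linear_mult_transpose_le[OF L_A(1) lin[OF lin_A L_A(1)] N_A_carr that]
      unfolding N_A(3) rhoA .
  qed
  have rev_B: "eval_rat_mat (rev_mat (int (\<rho>D + 1)) (rat_mat B)) 0 = coeff_mat (\<lambda>_. \<rho>D + 1) B"
  proof (rule eval_rev_rat_mat_0[OF B])
    show "degree (B $$ (i, j)) \<le> \<rho>D + 1" if "i < n" "j < m" for i j
      using degree_linear_mult_transpose_le[OF M_B(1) lin[OF M_B(2,1)] N_D_carr that]
      unfolding M_B(3) rhoD .
  qed
  interpret S: strong_block_minimal_system A B C D M_A K_A N_A M_D K_D N_D M_B M_C n m p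
    "\<rho>A * n" "(\<rho>A + 1) * n" "\<rho>D * m" "(\<rho>D + 1) * m"
  proof
    show "row_degree K_A i = 1" if "i < \<rho>A * n" for i
      using L_A(2,3) that by (simp add: strong_block_minimal_basis_pencil_def)
    show "row_degree K_D i = 1" if "i < \<rho>D * m" for i
      using L_D(2,3) that by (simp add: strong_block_minimal_basis_pencil_def)
    show "full_row_rank (append_cols (eval_poly_mat A x) (eval_poly_mat B x))" for x
      by (rule full_row_rank_of_rank[of _ n "n + m"])
        (use A(1) B rank_finite in \<open>simp_all add: eval_poly_mat_def\<close>)
    show "full_row_rank (append_cols (coeff_mat (\<lambda>_. mat_degree N_A + 1) A)
        (coeff_mat (\<lambda>_. mat_degree N_D + 1) B))"
      unfolding rhoA[symmetric] rhoD[symmetric]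
      by (rule full_row_rank_of_rank[of _ n "n + m"])
        (use A(1) B rank_infinite[unfolded rev_A rev_B] in \<open>simp_all add: coeff_mat_def\<close>)
  qed (use A L_A L_D M_B M_C N_A N_D lin_A lin_D N_A_carr N_D_carr in auto)
  let ?k = "n + \<rho>A * n" and ?l = "p + \<rho>D * m"
  have main: "set zs \<subseteq> carrier_vec (?k + ?l)"
      "left_minimal_basis R_hat (map (vec_slice ?k ?l) zs)"
      "left_minimal_basis R (map (vec_slice ?k p) zs)"
      "map vec_degree (map (vec_slice ?k ?l) zs) = map vec_degree zs"
      "map vec_degree (map (vec_slice ?k p) zs) = map vec_degree zs"
    if "left_minimal_basis (rat_mat L) zs" for zs
    using S.left_minimal_bases[of zs] that unfolding L R_hat R(3) by blast+
  have bases: "\<exists>ys xs us ws.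
           length ys = length zs \<and> length xs = length zs \<and>
           length us = length zs \<and> length ws = length zs \<and>
           left_minimal_basis R_hat xs \<and> left_minimal_basis R us \<and>
           (\<forall>i<length zs.
              ys ! i \<in> carrier_vec (n + \<rho>A * n) \<and> xs ! i \<in> carrier_vec (p + \<rho>D * m) \<and>
              zs ! i = ys ! i @\<^sub>v xs ! i \<and>
              us ! i \<in> carrier_vec p \<and> ws ! i \<in> carrier_vec (\<rho>D * m) \<and>
              xs ! i = us ! i @\<^sub>v ws ! i)"
    if zs: "left_minimal_basis (rat_mat L) zs" for zs
  proof (intro exI conjI allI impI)
    show "left_minimal_basis R_hat (map (vec_slice ?k ?l) zs)" by (rule main(2)[OF zs])
    show "left_minimal_basis R (map (vec_slice ?k p) zs)" by (rule main(3)[OF zs])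
    fix i assume i: "i < length zs"
    hence z: "zs ! i \<in> carrier_vec (?k + ?l)" using main(1)[OF zs] by auto
    show "zs ! i = map (vec_slice 0 ?k) zs ! i @\<^sub>v map (vec_slice ?k ?l) zs ! i"
      using i z by (intro eq_vecI) auto
    show "map (vec_slice ?k ?l) zs ! i = map (vec_slice ?k p) zs ! i @\<^sub>v map (vec_slice (?k + p) (\<rho>D * m)) zs ! i"
      using i z by (intro eq_vecI) (auto simp: add.assoc)
  qed simp_all
  have indices: "left_minimal_indices R_hat \<eta>s \<and> left_minimal_indices R \<eta>s"
    if \<eta>s: "left_minimal_indices (rat_mat L) \<eta>s" for \<eta>s
  proof -
    obtain zs where zs: "left_minimal_basis (rat_mat L) zs" "\<eta>s = sort (map vec_degree zs)"
      using \<eta>s by (auto simp: left_minimal_indices_def left_minimal_basis_def minimal_indices_def)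
    show ?thesis
      using main(2-5)[OF zs(1)] zs(2)
      unfolding left_minimal_indices_def left_minimal_basis_def minimal_indices_def by metis
  qed
  show ?thesis using bases indices by blast
qed

end
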